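(* Let $\varrho$ and $\sigma$ be states occupying $N(\varrho)$ and $N(\sigma)$ qubits respectively, and put $\Delta N=N(\sigma)-N(\varrho)$ and $\Delta S=S(\sigma)-S(\varrho)$. To produce the mixed-to-mixed transition $\varrho\to\sigma$ without access to noise, $\Delta N+\Delta S$ additional pure qubits (per copy) are necessary and sufficient.
   Context: $S(\varrho)=-\mathrm{Tr}\,\varrho\log\varrho$ is the von Neumann entropy (logarithm base $2$). A state of a $d$-level system is a positive semidefinite operator of trace $1$ on $\mathbb{C}^d$, and $N=\log d$ is the number of qubits it occupies. "Without access to noise" means that there is no free resource: maximally mixed ancillas are not available for free, and every qubit used is counted. A general protocol starts from $\varrho\otimes|\psi\rangle\langle\psi|$, where $|\psi\rangle$ is a pure state of the additional qubits, applies unitary transformations, and then traces out part of the system (the "garbage") to leave $\sigma$. The transition is considered in the limit of many copies, $\varrho^{\otimes n}\to\sigma^{\otimes n}$, with inaccuracy (in trace norm) vanishing as $n\to\infty$, and the number of additional pure qubits is counted per copy.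
   Formalization: Sufficiency is stated only for ΔS ≥ 0, since it fails for ΔS < 0 (a maximally mixed qubit to a pure two-qubit state has ΔN+ΔS = 0 but needs a qubit per copy); if ΔN+ΔS is negative, sufficient means that no additional pure qubits per copy are needed. Necessity is unrestricted. *)

theory Defs
  imports
    Complex_Main
    "HOL-Library.Extended_Real"
    "Jordan_Normal_Form.Schur_Decomposition"
begin

definition mat_trace :: "complex mat \<Rightarrow> complex" where
  "mat_trace A = (\<Sum>i<dim_row A. A $$ (i, i))"

definition unitary_mat :: "nat \<Rightarrow> complex mat \<Rightarrow> bool" where
  "unitary_mat n U \<longleftrightarrow> U \<in> carrier_mat n n \<and> mat_adjoint U * U = 1\<^sub>m n"

definition psd_mat :: "nat \<Rightarrow> complex mat \<Rightarrow> bool" where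
  "psd_mat n A \<longleftrightarrow> A \<in> carrier_mat n n \<and> mat_adjoint A = A \<and>
     (\<forall>v \<in> carrier_vec n. 0 \<le> Re ((A *\<^sub>v v) \<bullet>c v))"

definition density_mat :: "nat \<Rightarrow> complex mat \<Rightarrow> bool" where
  "density_mat d \<rho> \<longleftrightarrow> psd_mat d \<rho> \<and> mat_trace \<rho> = 1"

(* Functional calculus of a Hermitian matrix A. The matrix B does not depend on the
   spectral decomposition of A that is used; for A not Hermitian the value is junk. *)
definition herm_fun :: "(real \<Rightarrow> real) \<Rightarrow> complex mat \<Rightarrow> complex mat" where
  "herm_fun f A = (SOME B. \<exists>U a. unitary_mat (dim_row A) U \<and>
     A = U * mat_diag (dim_row A) (\<lambda>i. complex_of_real (a i)) * mat_adjoint U \<and>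
     B = U * mat_diag (dim_row A) (\<lambda>i. complex_of_real (f (a i))) * mat_adjoint U)"

(* HOL sets log 2 0 = 0; the value of the logarithm on the kernel of \<rho> is irrelevant,
   because it is multiplied by \<rho>. *)
definition vn_entropy :: "complex mat \<Rightarrow> real" where
  "vn_entropy \<rho> = - Re (mat_trace (\<rho> * herm_fun (log 2) \<rho>))"

definition trace_norm :: "complex mat \<Rightarrow> real" where
  "trace_norm A = Re (mat_trace (herm_fun sqrt (mat_adjoint A * A)))"

definition qubits :: "complex mat \<Rightarrow> real" where
  "qubits \<rho> = log 2 (real (dim_row \<rho>))"

definition kron :: "complex mat \<Rightarrow> complex mat \<Rightarrow> complex mat" where
  "kron A B = mat (dim_row A * dim_row B) (dim_col A * dim_col B)
     (\<lambda>(i, j). A $$ (i div dim_row B, j div dim_col B) * B $$ (i mod dim_row B, j mod dim_col B))"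

primrec tensor_power :: "complex mat \<Rightarrow> nat \<Rightarrow> complex mat" where
  "tensor_power A 0 = 1\<^sub>m 1"
| "tensor_power A (Suc n) = kron A (tensor_power A n)"

(* Trace over the second factor of an a-dimensional times a b-dimensional system. *)
definition partial_trace :: "nat \<Rightarrow> nat \<Rightarrow> complex mat \<Rightarrow> complex mat" where
  "partial_trace a b M = mat a a (\<lambda>(i, j). \<Sum>l<b. M $$ (i * b + l, j * b + l))"

definition projector :: "complex vec \<Rightarrow> complex mat" where
  "projector \<psi> = mat (dim_vec \<psi>) (dim_vec \<psi>) (\<lambda>(i, j). \<psi> $ i * cnj (\<psi> $ j))"

(* Number of whole qubits that hold n copies of \<rho>, i.e. the least m with d ^ n \<le> 2 ^ m for
   a d-level system. Per copy it tends to qubits \<rho>, and it equals n * qubits \<rho> if d is a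
   power of 2. *)
definition copy_qubits :: "complex mat \<Rightarrow> nat \<Rightarrow> nat" where
  "copy_qubits \<rho> n = nat \<lceil>real n * qubits \<rho>\<rceil>"

(* The n-th tensor power of \<rho>, stored in a register of copy_qubits \<rho> n qubits (whose dimension
   may exceed d ^ n): the remaining basis vectors of the register have weight 0. *)
definition copies :: "complex mat \<Rightarrow> nat \<Rightarrow> complex mat" where
  "copies \<rho> n = mat (2 ^ copy_qubits \<rho> n) (2 ^ copy_qubits \<rho> n)
     (\<lambda>(i, j). if i < dim_row \<rho> ^ n \<and> j < dim_row \<rho> ^ n then tensor_power \<rho> n $$ (i, j) else 0)"

(* Output of one run on n copies: k pure qubits in the state \<psi> are appended, U is applied to all
   qubits, and the last g qubits (the garbage) are traced out. *)
definition protocol_output ::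
  "complex mat \<Rightarrow> complex mat \<Rightarrow> nat \<Rightarrow> nat \<Rightarrow> complex vec \<Rightarrow> complex mat \<Rightarrow> complex mat" where
  "protocol_output \<rho> \<sigma> n g \<psi> U =
     partial_trace (2 ^ copy_qubits \<sigma> n) (2 ^ g)
       (U * kron (copies \<rho> n) (projector \<psi>) * mat_adjoint U)"

(* No free resource: the qubits at the end (output and garbage) are exactly those at the start
   (input and additional pure qubits). *)
definition noiseless_protocol ::
  "complex mat \<Rightarrow> complex mat \<Rightarrow>
   (nat \<Rightarrow> nat) \<Rightarrow> (nat \<Rightarrow> nat) \<Rightarrow> (nat \<Rightarrow> complex vec) \<Rightarrow> (nat \<Rightarrow> complex mat) \<Rightarrow> bool" where
  "noiseless_protocol \<rho> \<sigma> k g \<psi> U \<longleftrightarrow>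
     (\<forall>n. copy_qubits \<rho> n + k n = copy_qubits \<sigma> n + g n \<and>
          \<psi> n \<in> carrier_vec (2 ^ k n) \<and> \<psi> n \<bullet>c \<psi> n = 1 \<and>
          unitary_mat (2 ^ (copy_qubits \<rho> n + k n)) (U n)) \<and>
     (\<lambda>n. trace_norm (protocol_output \<rho> \<sigma> n (g n) (\<psi> n) (U n) - copies \<sigma> n)) \<longlonglongrightarrow> 0"

end

theory Submission
  imports Defs "Jordan_Normal_Form.Spectral_Radius" "HOL-Real_Asymp.Real_Asymp"
begin

text \<open>
  Necessity. Restrict the input to the typical eigenvectors of \<open>\<rho>\<^sup>n\<close>, about \<open>2 powr (n * S \<rho>)\<close> of them.
  Tracing out \<open>g\<close> qubits turns each eigenvector of the global state into a mixture of \<open>2 ^ g\<close> vectors,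
  so up to small weight the output lives on a subspace of dimension \<open>2 powr (n * S \<rho> + g)\<close>. On a
  subspace of dimension much below \<open>2 powr (n * S \<sigma>)\<close> the state \<open>\<sigma>\<^sup>n\<close> has almost no weight, hence
  \<open>g\<close> is at least about \<open>n * \<Delta>S\<close>, and counting qubits gives the bound on \<open>k\<close>.

  Sufficiency. Place the typical weights of \<open>\<rho>\<^sup>n\<close> and of \<open>\<sigma>\<^sup>n\<close> as consecutive intervals on \<open>[0, 1]\<close>; the
  overlap \<open>c r s\<close> of the \<open>r\<close>-th and the \<open>s\<close>-th interval is a coupling of the two distributions, supported on a
  staircase. Send the \<open>r\<close>-th eigenvector of \<open>\<rho>\<^sup>n\<close> to the superposition over \<open>s\<close> of (\<open>s\<close>-th eigenvector of
  \<open>\<sigma>\<^sup>n\<close>) \<open>\<otimes>\<close> (garbage basis vector \<open>r + s mod 2 ^ g\<close>) with amplitudes \<open>sqrt (c r s / p r)\<close>. As soon as \<open>2 ^ g\<close>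
  exceeds all weight ratios, pairs on the staircase that share \<open>r\<close> or share \<open>s\<close> get distinct garbage, so these
  vectors are orthonormal and their reduced states are diagonal with the right weights. Since
  \<open>\<Delta>S \<ge> 0\<close>, \<open>g = n * \<Delta>S + o(n)\<close> suffices.
\<close>

section \<open>Orthonormal families and the spectral theorem\<close>

text \<open>Vectors are functions on all of nat of which only the first \<open>N\<close> entries
  count, so that embedding, slicing and reindexing need no carrier conditions. The second argument
  is conjugated, as in \<open>\<bullet>c\<close>.\<close>

definition iprod :: "nat \<Rightarrow> (nat \<Rightarrow> complex) \<Rightarrow> (nat \<Rightarrow> complex) \<Rightarrow> complex" where
  "iprod N u v = (\<Sum>i<N. u i * cnj (v i))"

definition norm_sq :: "nat \<Rightarrow> (nat \<Rightarrow> complex) \<Rightarrow> real" where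
  "norm_sq N v = (\<Sum>i<N. (cmod (v i))\<^sup>2)"

definition orthonormal :: "nat \<Rightarrow> 'a set \<Rightarrow> ('a \<Rightarrow> nat \<Rightarrow> complex) \<Rightarrow> bool" where
  "orthonormal N A u \<longleftrightarrow> (\<forall>x\<in>A. \<forall>y\<in>A. iprod N (u x) (u y) = (if x = y then 1 else 0))"

lemma orthonormalD:
  "orthonormal N A u \<Longrightarrow> x \<in> A \<Longrightarrow> y \<in> A \<Longrightarrow> iprod N (u x) (u y) = (if x = y then 1 else 0)"
  unfolding orthonormal_def by blast

lemma iprod_self: "iprod N v v = of_real (norm_sq N v)"
  unfolding iprod_def norm_sq_def by (simp add: complex_norm_square [symmetric] flip: of_real_power)

lemma norm_sq_nonneg: "0 \<le> norm_sq N v"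
  unfolding norm_sq_def by (simp add: sum_nonneg)

lemma iprod_cnj: "cnj (iprod N u v) = iprod N v u"
  unfolding iprod_def by (simp add: mult.commute)

lemma iprod_sum_left: "iprod N (\<lambda>i. \<Sum>x\<in>A. c x * u x i) v = (\<Sum>x\<in>A. c x * iprod N (u x) v)"
  unfolding iprod_def sum_distrib_right sum_distrib_left
  by (subst sum.swap) (simp add: mult.assoc)

lemma iprod_sum_right: "iprod N v (\<lambda>i. \<Sum>x\<in>A. c x * u x i) = (\<Sum>x\<in>A. cnj (c x) * iprod N v (u x))"
  unfolding iprod_def cnj_sum sum_distrib_left
  by (subst sum.swap) (simp add: mult_ac)

lemma iprod_diff_left: "iprod N (\<lambda>i. u i - w i) v = iprod N u v - iprod N w v"
  unfolding iprod_def by (simp add: left_diff_distrib sum_subtractf)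

lemma iprod_diff_right: "iprod N v (\<lambda>i. u i - w i) = iprod N v u - iprod N v w"
  unfolding iprod_def by (simp add: right_diff_distrib sum_subtractf)

lemma iprod_scale_left: "iprod N (\<lambda>i. c * u i) v = c * iprod N u v"
  unfolding iprod_def by (simp add: sum_distrib_left mult.assoc)

lemma iprod_scale_right: "iprod N v (\<lambda>i. c * u i) = cnj c * iprod N v u"
  unfolding iprod_def by (simp add: sum_distrib_left mult_ac)

lemma iprod_cong: "(\<And>i. i < N \<Longrightarrow> u i = u' i) \<Longrightarrow> (\<And>i. i < N \<Longrightarrow> v i = v' i) \<Longrightarrow> iprod N u v = iprod N u' v'"
  unfolding iprod_def by (intro sum.cong) auto

lemma norm_sq_eq_0D: "norm_sq N v = 0 \<Longrightarrow> i < N \<Longrightarrow> v i = 0"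
  unfolding norm_sq_def by (subst (asm) sum_nonneg_eq_0_iff) auto

lemma orthonormal_norm_sq: "orthonormal N A u \<Longrightarrow> x \<in> A \<Longrightarrow> norm_sq N (u x) = 1"
  using orthonormalD[of N A u x x] by (simp add: iprod_self)

section \<open>Residuals, Bessel's inequality and completion to an orthonormal basis\<close>

definition residual :: "nat \<Rightarrow> 'a set \<Rightarrow> ('a \<Rightarrow> nat \<Rightarrow> complex) \<Rightarrow> (nat \<Rightarrow> complex) \<Rightarrow> nat \<Rightarrow> complex" where
  "residual N A u v i = v i - (\<Sum>x\<in>A. iprod N v (u x) * u x i)"

lemma iprod_residual:
  assumes "orthonormal N A u" "finite A" "y \<in> A"
  shows "iprod N (residual N A u v) (u y) = 0"
proof -
  have "iprod N (residual N A u v) (u y) = iprod N v (u y) - (\<Sum>x\<in>A. iprod N v (u x) * iprod N (u x) (u y))"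
    unfolding residual_def by (simp add: iprod_diff_left iprod_sum_left)
  also have "(\<Sum>x\<in>A. iprod N v (u x) * iprod N (u x) (u y)) = (\<Sum>x\<in>A. if x = y then iprod N v (u x) else 0)"
    using assms by (intro sum.cong) (auto simp: orthonormalD)
  finally show ?thesis using assms by simp
qed

lemma iprod_residual_self:
  assumes "orthonormal N A u" "finite A"
  shows "iprod N v (residual N A u v) = of_real (norm_sq N v - (\<Sum>x\<in>A. (cmod (iprod N v (u x)))\<^sup>2))"
proof -
  have "iprod N v (\<lambda>i. \<Sum>x\<in>A. iprod N v (u x) * u x i) = (\<Sum>x\<in>A. of_real ((cmod (iprod N v (u x)))\<^sup>2))"
    unfolding iprod_sum_right by (intro sum.cong) (auto simp: complex_norm_square mult.commute simp del: of_real_power)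
  then show ?thesis
    unfolding residual_def by (simp add: iprod_diff_right iprod_self)
qed

lemma norm_sq_residual:
  assumes "orthonormal N A u" "finite A"
  shows "norm_sq N (residual N A u v) = norm_sq N v - (\<Sum>x\<in>A. (cmod (iprod N v (u x)))\<^sup>2)"
proof -
  have "iprod N (residual N A u v) (residual N A u v)
      = iprod N v (residual N A u v) - (\<Sum>x\<in>A. iprod N v (u x) * iprod N (u x) (residual N A u v))"
    by (subst residual_def [abs_def]) (simp add: iprod_diff_left iprod_sum_left)
  also have "(\<Sum>x\<in>A. iprod N v (u x) * iprod N (u x) (residual N A u v)) = 0"
    using iprod_residual[OF assms] by (subst iprod_cnj[symmetric]) simp
  finally have "iprod N (residual N A u v) (residual N A u v)
      = of_real (norm_sq N v - (\<Sum>x\<in>A. (cmod (iprod N v (u x)))\<^sup>2))"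
    using iprod_residual_self[OF assms] by simp
  then show ?thesis unfolding iprod_self of_real_eq_iff .
qed

lemma bessel:
  assumes "orthonormal N A u" "finite A"
  shows "(\<Sum>x\<in>A. (cmod (iprod N v (u x)))\<^sup>2) \<le> norm_sq N v"
  using norm_sq_residual[OF assms, of v] norm_sq_nonneg[of N "residual N A u v"] by linarith

lemma bessel':
  assumes "orthonormal N A u" "finite A"
  shows "(\<Sum>x\<in>A. (cmod (iprod N (u x) v))\<^sup>2) \<le> norm_sq N v"
proof -
  have "cmod (iprod N (u x) v) = cmod (iprod N v (u x))" for x
    by (subst iprod_cnj[symmetric]) simp
  then show ?thesis using bessel[OF assms] by simp
qed

lemma orthonormal_extend1:
  assumes "orthonormal N {..<m::nat} u" and r: "\<And>x. x < m \<Longrightarrow> iprod N r (u x) = 0" and "norm_sq N r \<noteq> 0"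
  shows "orthonormal N {..<Suc m} (u(m := (\<lambda>i. of_real (1 / sqrt (norm_sq N r)) * r i)))"
proof -
  let ?r = "\<lambda>i. complex_of_real (1 / sqrt (norm_sq N r)) * r i"
  have "iprod N ?r ?r = of_real (1 / sqrt (norm_sq N r) * (1 / sqrt (norm_sq N r)) * norm_sq N r)"
    unfolding iprod_scale_left iprod_scale_right iprod_self[of N r] of_real_mult complex_cnj_complex_of_real
    by (simp only: mult.assoc)
  also have "1 / sqrt (norm_sq N r) * (1 / sqrt (norm_sq N r)) * norm_sq N r = 1"
    using assms(3) norm_sq_nonneg[of N r] by simp
  finally have "iprod N ?r ?r = 1" by simp
  moreover have "iprod N ?r (u x) = 0" "iprod N (u x) ?r = 0" if "x < m" for x
    unfolding iprod_scale_left iprod_scale_right using r[OF that] iprod_cnj[of N r "u x"] by auto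
  ultimately show ?thesis using assms(1)
    unfolding orthonormal_def by (auto simp: less_Suc_eq)
qed

lemma iprod_delta: "i < N \<Longrightarrow> iprod N (\<lambda>j. if j = i then 1 else 0) v = cnj (v i)"
  unfolding iprod_def by (simp add: if_distrib[of "\<lambda>z. z * _"] cong: if_cong)

text \<open>Dimension count: if every residual vanished, Bessel's inequality would be an equality
  for each standard basis vector, and summing the squared moduli of all entries in both orders would
  give \<open>N = card A\<close>.\<close>

lemma orthonormal_exists_residual:
  assumes "orthonormal N A u" "finite A" "card A < N"
  shows "\<exists>v. norm_sq N (residual N A u v) \<noteq> 0"
proof (rule ccontr)
  assume "\<not> ?thesis"
  then have *: "norm_sq N (residual N A u v) = 0" for v by blast
  let ?e = "\<lambda>i j. if j = i then 1 else (0::complex)"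
  have e: "norm_sq N (?e i) = 1" if "i < N" for i
    using iprod_delta[OF that, of "?e i"] by (simp add: iprod_self)
  have "real N = (\<Sum>i<N. norm_sq N (?e i))" using e by simp
  also have "\<dots> = (\<Sum>i<N. \<Sum>x\<in>A. (cmod (iprod N (?e i) (u x)))\<^sup>2)"
    using * norm_sq_residual[OF assms(1,2)] by (intro sum.cong) auto
  also have "\<dots> = (\<Sum>x\<in>A. \<Sum>i<N. (cmod (u x i))\<^sup>2)"
    by (subst sum.swap) (simp add: iprod_delta)
  also have "\<dots> = real (card A)"
    using orthonormal_norm_sq[OF assms(1)] unfolding norm_sq_def by simp
  finally show False using assms(3) by simp
qed

text \<open>Induction on the number \<open>N - m\<close> of missing vectors: a nonzero residual is
  normalised and appended.\<close>

lemma orthonormal_extend: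
  assumes "orthonormal N {..<m::nat} u" "m \<le> N"
  shows "\<exists>u'. orthonormal N {..<N} u' \<and> (\<forall>x<m. u' x = u x)"
  using assms
proof (induction "N - m" arbitrary: m u)
  case 0
  then show ?case by (intro exI[of _ u]) auto
next
  case (Suc k)
  from Suc.hyps(2) have "m < N" by simp
  then obtain v where v: "norm_sq N (residual N {..<m} u v) \<noteq> 0"
    using orthonormal_exists_residual[OF Suc.prems(1)] by auto
  let ?u = "u(m := (\<lambda>i. of_real (1 / sqrt (norm_sq N (residual N {..<m} u v))) * residual N {..<m} u v i))"
  have "orthonormal N {..<Suc m} ?u"
    using Suc.prems(1) v by (intro orthonormal_extend1) (auto intro: iprod_residual)
  then obtain u' where "orthonormal N {..<N} u'" "\<forall>x<Suc m. u' x = ?u x"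
    using Suc.hyps(1)[of "Suc m" ?u] Suc.hyps(2) \<open>m < N\<close> by (metis Suc_leI diff_Suc_eq_diff_pred diff_Suc_1 diff_commute Suc_diff_Suc)
  then show ?case by (intro exI[of _ u']) auto
qed

text \<open>The family \<open>u\<close> spans all \<open>w z\<close>; equality in Bessel's inequality says so without a projector.\<close>

lemma orthonormal_capture:
  assumes "finite W"
  shows "\<exists>m u. m \<le> card W \<and> orthonormal N {..<m::nat} u \<and>
    (\<forall>z\<in>W. (\<Sum>r<m. (cmod (iprod N (w z) (u r)))\<^sup>2) = norm_sq N (w z))"
  using assms
proof (induction W rule: finite_induct)
  case empty
  show ?case by (intro exI[of _ 0]) (simp add: orthonormal_def)
next
  case (insert z W)
  then obtain m u where mu: "m \<le> card W" "orthonormal N {..<m::nat} u"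
    "\<And>z. z \<in> W \<Longrightarrow> (\<Sum>r<m. (cmod (iprod N (w z) (u r)))\<^sup>2) = norm_sq N (w z)" by auto
  let ?r = "residual N {..<m} u (w z)"
  show ?case
  proof (cases "norm_sq N ?r = 0")
    case True
    then have "(\<Sum>r<m. (cmod (iprod N (w z) (u r)))\<^sup>2) = norm_sq N (w z)"
      using norm_sq_residual[OF mu(2)] by simp
    then show ?thesis using mu insert.hyps by (intro exI[of _ m] exI[of _ u]) auto
  next
    case False
    let ?u = "u(m := (\<lambda>i. of_real (1 / sqrt (norm_sq N ?r)) * ?r i))"
    have o: "orthonormal N {..<Suc m} ?u"
      using mu(2) False by (intro orthonormal_extend1) (auto intro: iprod_residual)
    have split: "(\<Sum>r<Suc m. (cmod (iprod N v (?u r)))\<^sup>2)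
        = (\<Sum>r<m. (cmod (iprod N v (u r)))\<^sup>2) + (cmod (iprod N v (?u m)))\<^sup>2" for v
      by simp
    \<comment> \<open>A vector already captured stays captured: the enlarged sum is at least the old
      one, which equals the full norm, and Bessel's inequality bounds it from above.\<close>
    have "(\<Sum>r<Suc m. (cmod (iprod N (w y) (?u r)))\<^sup>2) = norm_sq N (w y)" if "y \<in> W" for y
      using split[of "w y"] bessel[OF o, of "w y"] mu(3)[OF that] by (smt (verit) finite_lessThan zero_le_power2)
    moreover have "(\<Sum>r<Suc m. (cmod (iprod N (w z) (?u r)))\<^sup>2) = norm_sq N (w z)"
    proof -
      \<comment> \<open>The inner product of \<open>w z\<close> with its residual is the squared
        norm of the residual, so the new unit vector supplies exactly the missing part of the
        norm.\<close>
      have "iprod N (w z) (?u m) = of_real (1 / sqrt (norm_sq N ?r)) * of_real (norm_sq N ?r)"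
        using iprod_residual_self[OF mu(2), of "w z"] unfolding norm_sq_residual[OF mu(2), of "w z", simplified, symmetric]
        by (simp add: iprod_scale_right del: of_real_divide)
      also have "\<dots> = of_real (sqrt (norm_sq N ?r))"
        by (simp add: norm_sq_nonneg real_div_sqrt flip: of_real_mult of_real_divide)
      finally have "(cmod (iprod N (w z) (?u m)))\<^sup>2 = norm_sq N ?r"
        by (simp add: norm_sq_nonneg)
      then show ?thesis using split[of "w z"] norm_sq_residual[OF mu(2), of "w z"] by simp
    qed
    ultimately have "\<forall>y\<in>insert z W. (\<Sum>r<Suc m. (cmod (iprod N (w y) (?u r)))\<^sup>2) = norm_sq N (w y)"
      by blast
    moreover have "Suc m \<le> card (insert z W)" using mu(1) insert.hyps by simp
    ultimately show ?thesis using o by blast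
  qed
qed

text \<open>A nonzero residual could be normalised and appended, giving \<open>N + 1\<close>
  orthonormal vectors; Bessel's inequality summed over the standard basis leaves room for only
  \<open>N\<close>.\<close>

lemma onb_expand:
  assumes "orthonormal N {..<N} u" "i < N"
  shows "v i = (\<Sum>x<N. iprod N v (u x) * u x i)"
proof (rule ccontr)
  assume "\<not> ?thesis"
  then have "residual N {..<N} u v i \<noteq> 0" unfolding residual_def by simp
  then have n0: "norm_sq N (residual N {..<N} u v) \<noteq> 0" using norm_sq_eq_0D assms(2) by blast
  then have o: "orthonormal N {..<Suc N}
      (u(N := (\<lambda>i. of_real (1 / sqrt (norm_sq N (residual N {..<N} u v))) * residual N {..<N} u v i)))"
      (is "orthonormal _ _ ?u")
    using assms by (intro orthonormal_extend1) (auto intro: iprod_residual)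
  have "real (Suc N) = (\<Sum>x<Suc N. norm_sq N (?u x))" using orthonormal_norm_sq[OF o] by simp
  also have "\<dots> = (\<Sum>i<N. \<Sum>x<Suc N. (cmod (iprod N (\<lambda>j. if j = i then 1 else 0) (?u x)))\<^sup>2)"
    unfolding norm_sq_def by (subst sum.swap) (simp add: iprod_delta)
  also have "\<dots> \<le> (\<Sum>i<N. norm_sq N (\<lambda>j. if j = i then 1 else 0))"
    by (intro sum_mono bessel[OF o]) auto
  also have "\<dots> = (\<Sum>i<N. 1)"
  proof (intro sum.cong refl)
    fix i assume "i \<in> {..<N}"
    then show "norm_sq N (\<lambda>j. if j = i then 1 else 0) = 1"
      using iprod_delta[of i N "\<lambda>j. if j = i then 1 else 0"] by (simp add: iprod_self)
  qed
  finally show False by simp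
qed

lemma onb_complete:
  assumes "orthonormal N {..<N} u" "i < N" "j < N"
  shows "(\<Sum>x<N. u x i * cnj (u x j)) = (if i = j then 1 else 0)"
proof -
  have "(if i = j then 1 else 0) = (\<Sum>x<N. iprod N (\<lambda>k. if k = j then 1 else 0) (u x) * u x i)"
    using onb_expand[OF assms(1,2), of "\<lambda>k. if k = j then 1 else 0"] by simp
  then show ?thesis using assms(3) by (simp add: iprod_delta mult.commute)
qed

lemma parseval:
  assumes "orthonormal N {..<N} u"
  shows "(\<Sum>x<N. (cmod (iprod N v (u x)))\<^sup>2) = norm_sq N v"
proof -
  have "norm_sq N (residual N {..<N} u v) = 0"
    using onb_expand[OF assms] unfolding norm_sq_def residual_def by simp
  then show ?thesis using norm_sq_residual[OF assms] by simp
qed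

section \<open>Eigenvectors of Hermitian matrices\<close>

lemma exists_eigenvector:
  assumes "0 < k"
  shows "\<exists>z l. norm_sq k z \<noteq> 0 \<and> (\<forall>r<k. (\<Sum>s<k. B r s * z s) = l * z r)"
proof -
  let ?B = "mat k k (\<lambda>(r, s). B r s) :: complex mat"
  have B: "?B \<in> carrier_mat k k" by simp
  obtain l where "eigenvalue ?B l"
    using spectrum_non_empty[OF B assms] unfolding spectrum_def by auto
  then obtain z where z: "z \<in> carrier_vec k" "z \<noteq> 0\<^sub>v k" "?B *\<^sub>v z = l \<cdot>\<^sub>v z"
    unfolding eigenvalue_def eigenvector_def by auto
  have "(\<Sum>s<k. B r s * z $ s) = l * z $ r" if "r < k" for r
  proof -
    have "(?B *\<^sub>v z) $ r = (\<Sum>s<k. B r s * z $ s)"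
      using that z(1) by (simp add: scalar_prod_def lessThan_atLeast0)
    then show ?thesis using z that by simp
  qed
  moreover have "norm_sq k (\<lambda>s. z $ s) \<noteq> 0"
  proof
    assume "norm_sq k (\<lambda>s. z $ s) = 0"
    then have "z = 0\<^sub>v k" using norm_sq_eq_0D[of k "\<lambda>s. z $ s"] z(1) by (intro eq_vecI) auto
    then show False using z(2) by simp
  qed
  ultimately show ?thesis by (intro exI[of _ "\<lambda>s. z $ s"] exI[of _ l]) auto
qed

definition matvec :: "nat \<Rightarrow> (nat \<Rightarrow> nat \<Rightarrow> complex) \<Rightarrow> (nat \<Rightarrow> complex) \<Rightarrow> nat \<Rightarrow> complex" where
  "matvec N M v i = (\<Sum>j<N. M i j * v j)"

lemma matvec_selfadj:
  assumes "\<And>i j. i < N \<Longrightarrow> j < N \<Longrightarrow> M j i = cnj (M i j)"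
  shows "iprod N (matvec N M u) v = iprod N u (matvec N M v)"
proof -
  have "iprod N (matvec N M u) v = (\<Sum>i<N. \<Sum>j<N. M i j * u j * cnj (v i))"
    unfolding iprod_def matvec_def by (simp add: sum_distrib_right)
  also have "\<dots> = (\<Sum>j<N. \<Sum>i<N. M i j * u j * cnj (v i))" by (rule sum.swap)
  also have "\<dots> = (\<Sum>j<N. \<Sum>i<N. u j * (cnj (M j i) * cnj (v i)))"
  proof (intro sum.cong refl)
    fix i j assume "i \<in> {..<N}" "j \<in> {..<N}"
    then have "M i j = cnj (M j i)" by (intro assms) auto
    then show "M i j * u j * cnj (v i) = u j * (cnj (M j i) * cnj (v i))" by (simp only: mult_ac)
  qed
  also have "\<dots> = iprod N u (matvec N M v)"
    unfolding iprod_def matvec_def by (simp add: sum_distrib_left)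
  finally show ?thesis .
qed

lemma matvec_sum: "matvec N M (\<lambda>i. \<Sum>x\<in>A. c x * u x i) i = (\<Sum>x\<in>A. c x * matvec N M (u x) i)"
  unfolding matvec_def sum_distrib_left by (subst sum.swap) (simp add: mult_ac)

lemma matvec_scale: "matvec N M (\<lambda>i. c * u i) i = c * matvec N M u i"
  unfolding matvec_def sum_distrib_left by (simp add: mult_ac)

text \<open>Induction on \<open>m\<close>. As \<open>M\<close> is self-adjoint, the orthogonal
  complement of the eigenvectors found so far is invariant. The compression of \<open>M\<close> to
  this complement has an eigenvector, being a complex matrix, and that vector lifts to an
  eigenvector of \<open>M\<close>.\<close>

lemma hermitian_eigenvectors:
  assumes herm: "\<And>i j. i < N \<Longrightarrow> j < N \<Longrightarrow> M j i = cnj (M i j)" and "m \<le> N"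
  shows "\<exists>u a. orthonormal N {..<m} u \<and> (\<forall>x<m. \<forall>i<N. matvec N M (u x) i = a x * u x i)"
  using assms(2)
proof (induction m)
  case 0
  show ?case by (simp add: orthonormal_def)
next
  case (Suc m)
  then obtain u0 a where u0: "orthonormal N {..<m} u0"
    "\<And>x i. x < m \<Longrightarrow> i < N \<Longrightarrow> matvec N M (u0 x) i = a x * u0 x i" by auto
  obtain u where u: "orthonormal N {..<N} u" "\<And>x. x < m \<Longrightarrow> u x = u0 x"
    using orthonormal_extend[OF u0(1)] Suc.prems by auto
  define k where "k = N - m"
  have k: "0 < k" "m + k = N" using Suc.prems unfolding k_def by auto
  \<comment> \<open>\<open>B\<close> is \<open>M\<close> compressed to the span of the remaining
    \<open>k\<close> basis vectors, in coordinates; \<open>v\<close> below is the vector of that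
    span with coordinates \<open>z\<close>.\<close>
  define B where "B r s = iprod N (matvec N M (u (m + s))) (u (m + r))" for r s
  obtain z l where z: "norm_sq k z \<noteq> 0" "\<And>r. r < k \<Longrightarrow> (\<Sum>s<k. B r s * z s) = l * z r"
    using exists_eigenvector[OF k(1), of B] by auto
  define v where "v i = (\<Sum>s<k. z s * u (m + s) i)" for i
  have ipv: "iprod N v (u x) = (if x < m then 0 else z (x - m))" if "x < N" for x
  proof -
    have "iprod N v (u x) = (\<Sum>s<k. z s * (if m + s = x then 1 else 0))"
      unfolding v_def iprod_sum_left using u(1) that k by (intro sum.cong) (auto simp: orthonormalD)
    also have "\<dots> = (\<Sum>s<k. if s = x - m then (if m \<le> x then z s else 0) else 0)"
      by (intro sum.cong) auto
    also have "\<dots> = (if x < m then 0 else z (x - m))" using that k by (simp add: sum.delta') auto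
    finally show ?thesis .
  qed
  have split: "(\<Sum>x<N. f x) = (\<Sum>x<m. f x) + (\<Sum>s<k. f (m + s))" for f :: "nat \<Rightarrow> 'b::comm_monoid_add"
  proof -
    have "(\<Sum>x<N. f x) = (\<Sum>x<m. f x) + (\<Sum>x=m..<m+k. f x)"
      unfolding k(2)[symmetric] lessThan_atLeast0 by (rule sum.atLeastLessThan_concat[symmetric]) auto
    also have "(\<Sum>x=m..<m+k. f x) = (\<Sum>s<k. f (m + s))"
      using sum.shift_bounds_nat_ivl[of f 0 m k] by (simp add: lessThan_atLeast0 add.commute)
    finally show ?thesis .
  qed
  have nv: "norm_sq N v \<noteq> 0"
  proof -
    have "norm_sq N v = (\<Sum>x<N. (cmod (iprod N v (u x)))\<^sup>2)" using parseval[OF u(1)] by simp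
    also have "\<dots> = (\<Sum>x<N. (cmod (if x < m then 0 else z (x - m)))\<^sup>2)" using ipv by simp
    also have "\<dots> = norm_sq k z" unfolding norm_sq_def split by simp
    finally show ?thesis using z(1) by simp
  qed
  \<comment> \<open>The eigenvector equation is checked coordinate by coordinate in the basis
    \<open>u\<close>. On the old eigenvectors self-adjointness moves \<open>M\<close> to the other
    side and both sides vanish; on the others it is the equation for \<open>B\<close> and
    \<open>z\<close>.\<close>
  have ipMv: "iprod N (matvec N M v) (u x) = l * iprod N v (u x)" if "x < N" for x
  proof (cases "x < m")
    case True
    have "iprod N (matvec N M v) (u x) = iprod N v (matvec N M (u x))" by (rule matvec_selfadj[OF herm])
    also have "\<dots> = iprod N v (\<lambda>i. a x * u x i)" using u0(2) u(2) True by (intro iprod_cong) auto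
    also have "\<dots> = 0" using ipv[OF that] True by (simp add: iprod_scale_right)
    finally show ?thesis using ipv[OF that] True by simp
  next
    case False
    define r where "r = x - m"
    have r: "x = m + r" "r < k" using that k False unfolding r_def by auto
    have "iprod N (matvec N M v) (u x) = iprod N (\<lambda>i. \<Sum>s<k. z s * matvec N M (u (m + s)) i) (u x)"
      unfolding v_def[abs_def] by (intro iprod_cong) (auto simp: matvec_sum)
    also have "\<dots> = (\<Sum>s<k. B r s * z s)"
      unfolding iprod_sum_left B_def r by (simp add: mult.commute)
    finally show ?thesis using z(2)[OF r(2)] ipv[OF that] r by simp
  qed
  have Mv: "matvec N M v i = l * v i" if "i < N" for i
  proof -
    have "matvec N M v i = (\<Sum>x<N. iprod N (matvec N M v) (u x) * u x i)" by (rule onb_expand[OF u(1) that])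
    also have "\<dots> = (\<Sum>x<N. l * (iprod N v (u x) * u x i))" using ipMv by (intro sum.cong) auto
    also have "\<dots> = l * v i"
      using onb_expand[OF u(1) that, of v] by (simp add: sum_distrib_left)
    finally show ?thesis .
  qed
  define w where "w = u0(m := (\<lambda>i. of_real (1 / sqrt (norm_sq N v)) * v i))"
  define b where "b = a(m := l)"
  have "orthonormal N {..<Suc m} w"
    unfolding w_def
  proof (rule orthonormal_extend1[OF u0(1) _ nv])
    fix x assume "x < m"
    then show "iprod N v (u0 x) = 0" using ipv[of x] u(2)[of x] Suc.prems by simp
  qed
  moreover have "\<forall>x<Suc m. \<forall>i<N. matvec N M (w x) i = b x * w x i"
  proof (intro allI impI)
    fix x i assume that: "x < Suc m" "i < N"
    show "matvec N M (w x) i = b x * w x i"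
    proof (cases "x = m")
      case True
      then have "matvec N M (w x) i = of_real (1 / sqrt (norm_sq N v)) * matvec N M v i"
        unfolding w_def by (simp only: fun_upd_same matvec_scale)
      then show ?thesis using True Mv[OF that(2)] by (simp add: w_def b_def)
    next
      case False
      then show ?thesis using u0(2)[of x i] that by (simp add: w_def b_def)
    qed
  qed
  ultimately have "orthonormal N {..<Suc m} w \<and> (\<forall>x<Suc m. \<forall>i<N. matvec N M (w x) i = b x * w x i)"
    by simp
  then have "\<exists>a. orthonormal N {..<Suc m} w \<and> (\<forall>x<Suc m. \<forall>i<N. matvec N M (w x) i = a x * w x i)"
    by (rule exI[where x = b])
  then show ?case
    by (rule exI[where x = w])
qed

theorem spectral_decomposition:
  assumes herm: "\<And>i j. i < N \<Longrightarrow> j < N \<Longrightarrow> M j i = cnj (M i j)"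
  shows "\<exists>u a. orthonormal N {..<N} u \<and>
    (\<forall>i<N. \<forall>j<N. M i j = (\<Sum>x<N. of_real (a x) * u x i * cnj (u x j)))"
proof -
  have "\<exists>u a. orthonormal N {..<N} u \<and> (\<forall>x<N. \<forall>i<N. matvec N M (u x) i = a x * u x i)"
    by (rule hermitian_eigenvectors) (rule herm, assumption+, rule order.refl)
  then obtain u a where u: "orthonormal N {..<N} u"
    and ev: "\<And>x i. x < N \<Longrightarrow> i < N \<Longrightarrow> matvec N M (u x) i = a x * u x i"
    by blast
  have real: "of_real (Re (a x)) = a x" if "x < N" for x
  proof -
    have "a x * iprod N (u x) (u x) = iprod N (matvec N M (u x)) (u x)"
      unfolding iprod_scale_left[symmetric] using ev that by (intro iprod_cong) auto
    also have "\<dots> = iprod N (u x) (matvec N M (u x))" by (rule matvec_selfadj[OF herm])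
    also have "\<dots> = cnj (a x) * iprod N (u x) (u x)"
      unfolding iprod_scale_right[symmetric] using ev that by (intro iprod_cong) auto
    finally have "a x = cnj (a x)" using orthonormalD[OF u, of x x] that by simp
    then show ?thesis by (metis Reals_cnj_iff of_real_Re)
  qed
  have "M i j = (\<Sum>x<N. of_real (Re (a x)) * u x i * cnj (u x j))" if ij: "i < N" "j < N" for i j
  proof -
    have "M i j = (\<Sum>k<N. M i k * (if k = j then 1 else 0))"
      using ij by (simp add: if_distrib[of "\<lambda>z. _ * z"] cong: if_cong)
    also have "\<dots> = (\<Sum>k<N. M i k * (\<Sum>x<N. u x k * cnj (u x j)))"
      using onb_complete[OF u] ij by (intro sum.cong) auto
    also have "\<dots> = (\<Sum>k<N. \<Sum>x<N. M i k * u x k * cnj (u x j))"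
      by (simp add: sum_distrib_left mult.assoc)
    also have "\<dots> = (\<Sum>x<N. \<Sum>k<N. M i k * u x k * cnj (u x j))"
      by (rule sum.swap)
    also have "\<dots> = (\<Sum>x<N. matvec N M (u x) i * cnj (u x j))"
      by (simp add: matvec_def sum_distrib_right)
    also have "\<dots> = (\<Sum>x<N. of_real (Re (a x)) * u x i * cnj (u x j))"
      using ev ij real by (intro sum.cong) auto
    finally show ?thesis .
  qed
  with u show ?thesis by (intro exI[of _ u] exI[of _ "\<lambda>x. Re (a x)"]) auto
qed

section \<open>Spectral decompositions, entropy and trace norm\<close>

lemma mat_adjoint_carrier: "A \<in> carrier_mat n m \<Longrightarrow> mat_adjoint A \<in> carrier_mat m n"
  for A :: "complex mat"
  unfolding mat_adjoint_def by (simp add: mat_of_rows_def)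

lemma mat_adjoint_index:
  fixes A :: "complex mat"
  assumes "A \<in> carrier_mat n m" "i < m" "j < n"
  shows "mat_adjoint A $$ (i, j) = cnj (A $$ (j, i))"
  using assms unfolding mat_adjoint_def by (auto simp: mat_of_rows_def conjugate_complex_def)

lemma times_mat_index:
  assumes "A \<in> carrier_mat n k" "B \<in> carrier_mat k m" "i < n" "j < m"
  shows "(A * B) $$ (i, j) = (\<Sum>l<k. A $$ (i, l) * B $$ (l, j))"
  using assms by (auto simp: scalar_prod_def lessThan_atLeast0)

lemma unitary_mat_iff:
  assumes "U \<in> carrier_mat N N"
  shows "unitary_mat N U \<longleftrightarrow> orthonormal N {..<N} (\<lambda>x i. U $$ (i, x))"
proof -
  have *: "(mat_adjoint U * U) $$ (y, x) = iprod N (\<lambda>i. U $$ (i, x)) (\<lambda>i. U $$ (i, y))"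
    if "x < N" "y < N" for x y
    using times_mat_index[OF mat_adjoint_carrier[OF assms] assms that(2,1)] that
    by (simp add: mat_adjoint_index[OF assms] iprod_def mult.commute)
  have "mat_adjoint U * U \<in> carrier_mat N N"
    using assms mat_adjoint_carrier[OF assms] by simp
  then have "mat_adjoint U * U = 1\<^sub>m N \<longleftrightarrow> (\<forall>x<N. \<forall>y<N. (mat_adjoint U * U) $$ (y, x) = 1\<^sub>m N $$ (y, x))"
    by (metis carrier_matD eq_matI one_carrier_mat)
  also have "\<dots> \<longleftrightarrow> orthonormal N {..<N} (\<lambda>x i. U $$ (i, x))"
    unfolding orthonormal_def using * by auto
  finally show ?thesis using assms unfolding unitary_mat_def by simp
qed

text \<open>A weighted sum of rank-one matrices. The vectors \<open>h z\<close> may be neither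
  normalised nor orthogonal and the weights may be negative, so the form survives partial traces and
  differences of states.\<close>

definition outer :: "nat \<Rightarrow> complex mat \<Rightarrow> 'a set \<Rightarrow> ('a \<Rightarrow> real) \<Rightarrow> ('a \<Rightarrow> nat \<Rightarrow> complex) \<Rightarrow> bool" where
  "outer N A Z w h \<longleftrightarrow> A \<in> carrier_mat N N \<and>
     (\<forall>i<N. \<forall>j<N. A $$ (i, j) = (\<Sum>z\<in>Z. of_real (w z) * h z i * cnj (h z j)))"

definition decomp :: "nat \<Rightarrow> complex mat \<Rightarrow> (nat \<Rightarrow> nat \<Rightarrow> complex) \<Rightarrow> (nat \<Rightarrow> real) \<Rightarrow> bool" where
  "decomp N A u a \<longleftrightarrow> orthonormal N {..<N} u \<and> outer N A {..<N} a u"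

lemma outerD: "outer N A Z w h \<Longrightarrow> A \<in> carrier_mat N N"
  "outer N A Z w h \<Longrightarrow> i < N \<Longrightarrow> j < N \<Longrightarrow> A $$ (i, j) = (\<Sum>z\<in>Z. of_real (w z) * h z i * cnj (h z j))"
  unfolding outer_def by auto

lemma outer_matvec:
  assumes "outer N A Z w h" "i < N"
  shows "matvec N (\<lambda>i j. A $$ (i, j)) v i = (\<Sum>z\<in>Z. of_real (w z) * iprod N v (h z) * h z i)"
proof -
  have "matvec N (\<lambda>i j. A $$ (i, j)) v i = (\<Sum>j<N. \<Sum>z\<in>Z. of_real (w z) * h z i * cnj (h z j) * v j)"
    unfolding matvec_def using outerD(2)[OF assms(1,2)] by (simp add: sum_distrib_right)
  also have "\<dots> = (\<Sum>z\<in>Z. \<Sum>j<N. of_real (w z) * h z i * cnj (h z j) * v j)"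
    by (rule sum.swap)
  also have "\<dots> = (\<Sum>z\<in>Z. of_real (w z) * iprod N v (h z) * h z i)"
    by (intro sum.cong refl) (simp add: iprod_def sum_distrib_left sum_distrib_right mult_ac)
  finally show ?thesis .
qed

text \<open>Two decompositions of one matrix give the same quadratic form; this is how eigenvalues
  are later compared with the weights of other decompositions.\<close>

lemma outer_quad:
  assumes "outer N A Z w h"
  shows "iprod N (matvec N (\<lambda>i j. A $$ (i, j)) v) v = of_real (\<Sum>z\<in>Z. w z * (cmod (iprod N v (h z)))\<^sup>2)"
proof -
  have "iprod N (matvec N (\<lambda>i j. A $$ (i, j)) v) v = iprod N (\<lambda>i. \<Sum>z\<in>Z. of_real (w z) * iprod N v (h z) * h z i) v"
    using outer_matvec[OF assms] by (intro iprod_cong) auto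
  also have "\<dots> = (\<Sum>z\<in>Z. of_real (w z) * iprod N v (h z) * iprod N (h z) v)"
    by (rule iprod_sum_left)
  also have "\<dots> = (\<Sum>z\<in>Z. of_real (w z * (cmod (iprod N v (h z)))\<^sup>2))"
  proof (intro sum.cong refl)
    fix z
    have "iprod N v (h z) * iprod N (h z) v = of_real ((cmod (iprod N v (h z)))\<^sup>2)"
      unfolding iprod_cnj[of N v "h z", symmetric] by (rule complex_norm_square[symmetric])
    then show "of_real (w z) * iprod N v (h z) * iprod N (h z) v = of_real (w z * (cmod (iprod N v (h z)))\<^sup>2)"
      by (simp only: mult.assoc of_real_mult)
  qed
  finally show ?thesis by simp
qed

lemma outer_herm:
  assumes "outer N A Z w h"
  shows "mat_adjoint A = A"
proof (rule eq_matI)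
  note A = outerD(1)[OF assms]
  show "dim_row (mat_adjoint A) = dim_row A" "dim_col (mat_adjoint A) = dim_col A"
    using A mat_adjoint_carrier[OF A] by auto
  fix i j assume "i < dim_row A" "j < dim_col A"
  then have "i < N" "j < N" using A by auto
  then show "mat_adjoint A $$ (i, j) = A $$ (i, j)"
    unfolding mat_adjoint_index[OF A \<open>i < N\<close> \<open>j < N\<close>] by (simp add: outerD(2)[OF assms] mult_ac)
qed

lemma herm_decomp:
  assumes "A \<in> carrier_mat N N" "mat_adjoint A = A"
  shows "\<exists>u a. decomp N A u a"
proof -
  have "A $$ (j, i) = cnj (A $$ (i, j))" if "i < N" "j < N" for i j
    using mat_adjoint_index[OF assms(1) that(2,1)] assms(2) by simp
  from spectral_decomposition[of N "\<lambda>i j. A $$ (i, j)", OF this]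
  show ?thesis unfolding decomp_def outer_def using assms(1) by auto
qed

lemma outer_decomp: "outer N A Z w h \<Longrightarrow> \<exists>u a. decomp N A u a"
  using herm_decomp outerD(1) outer_herm by blast

lemma decomp_matvec:
  assumes "decomp N A u a" "x < N" "i < N"
  shows "matvec N (\<lambda>i j. A $$ (i, j)) (u x) i = of_real (a x) * u x i"
proof -
  have o: "orthonormal N {..<N} u" and d: "outer N A {..<N} a u" using assms(1) unfolding decomp_def by auto
  have "matvec N (\<lambda>i j. A $$ (i, j)) (u x) i = (\<Sum>z<N. of_real (a z) * iprod N (u x) (u z) * u z i)"
    by (rule outer_matvec[OF d assms(3)])
  also have "\<dots> = (\<Sum>z<N. if x = z then of_real (a x) * u x i else 0)"
    using orthonormalD[OF o] assms(2) by (intro sum.cong) auto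
  finally show ?thesis using assms(2) by simp
qed

text \<open>Eigenvectors of \<open>A\<close> for different eigenvalues are orthogonal, so the functional calculus does not
  depend on the decomposition; this removes the choice in \<^const>\<open>herm_fun\<close>.\<close>

lemma decomp_unique:
  assumes A: "decomp N A u a" "decomp N A u' a'" and B: "decomp N B u' (\<lambda>x. f (a' x))"
  shows "decomp N B u (\<lambda>x. f (a x))"
proof -
  let ?M = "\<lambda>i j. A $$ (i, j)"
  have o: "orthonormal N {..<N} u" "orthonormal N {..<N} u'" and Ac: "outer N A {..<N} a u"
    using A unfolding decomp_def by auto
  have Bo: "outer N B {..<N} (\<lambda>x. f (a' x)) u'" using B unfolding decomp_def by auto
  have herm: "?M j i = cnj (?M i j)" if "i < N" "j < N" for i j
    using mat_adjoint_index[OF outerD(1)[OF Ac] that(2,1)] outer_herm[OF Ac] by simp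
  \<comment> \<open>Self-adjointness gives this identity for \<open>a x\<close> and
    \<open>a' y\<close> in place of their images under \<open>f\<close>. Hence the inner product is
    zero or the eigenvalues agree, and in both cases \<open>f\<close> may be applied.\<close>
  have w: "of_real (f (a x)) * iprod N (u x) (u' y) = of_real (f (a' y)) * iprod N (u x) (u' y)"
    if "x < N" "y < N" for x y
  proof -
    have "of_real (a x) * iprod N (u x) (u' y) = iprod N (matvec N ?M (u x)) (u' y)"
      unfolding iprod_scale_left[symmetric] using decomp_matvec[OF A(1) that(1)] by (intro iprod_cong) auto
    also have "\<dots> = iprod N (u x) (matvec N ?M (u' y))" by (rule matvec_selfadj) (rule herm)
    also have "\<dots> = cnj (of_real (a' y)) * iprod N (u x) (u' y)"
      unfolding iprod_scale_right[symmetric] using decomp_matvec[OF A(2) that(2)] by (intro iprod_cong) auto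
    finally show ?thesis by auto
  qed
  have "B $$ (i, j) = (\<Sum>x<N. of_real (f (a x)) * u x i * cnj (u x j))" if ij: "i < N" "j < N" for i j
  proof -
    have "B $$ (i, j) = (\<Sum>y<N. of_real (f (a' y)) * u' y i * cnj (u' y j))"
      using outerD(2)[OF Bo ij] .
    \<comment> \<open>\<open>u' y\<close> is expanded in the basis \<open>u\<close>. After the
      exchange of eigenvalues by \<open>w\<close>, the sum over \<open>y\<close> is the expansion of
      \<open>u x\<close> in the basis \<open>u'\<close>.\<close>
    also have "\<dots> = (\<Sum>y<N. of_real (f (a' y)) * (\<Sum>x<N. iprod N (u' y) (u x) * u x i) * cnj (u' y j))"
      using onb_expand[OF o(1) ij(1)] by (intro sum.cong refl) metis
    also have "\<dots> = (\<Sum>y<N. \<Sum>x<N. of_real (f (a' y)) * cnj (iprod N (u x) (u' y)) * u x i * cnj (u' y j))"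
      by (simp add: sum_distrib_left sum_distrib_right iprod_cnj mult.assoc)
    also have "\<dots> = (\<Sum>y<N. \<Sum>x<N. of_real (f (a x)) * u x i * cnj (iprod N (u x) (u' y) * u' y j))"
    proof (intro sum.cong refl)
      fix y x assume "y \<in> {..<N}" "x \<in> {..<N}"
      then have "cnj (of_real (f (a x)) * iprod N (u x) (u' y)) = cnj (of_real (f (a' y)) * iprod N (u x) (u' y))"
        using w by simp
      then show "of_real (f (a' y)) * cnj (iprod N (u x) (u' y)) * u x i * cnj (u' y j) =
        of_real (f (a x)) * u x i * cnj (iprod N (u x) (u' y) * u' y j)"
        by (auto simp: mult_ac)
    qed
    also have "\<dots> = (\<Sum>x<N. of_real (f (a x)) * u x i * cnj (\<Sum>y<N. iprod N (u x) (u' y) * u' y j))"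
      by (subst sum.swap) (simp add: sum_distrib_left)
    also have "\<dots> = (\<Sum>x<N. of_real (f (a x)) * u x i * cnj (u x j))"
      using onb_expand[OF o(2) ij(2)] by (intro sum.cong refl) metis
    finally show ?thesis .
  qed
  then show ?thesis using o(1) outerD(1)[OF Bo] unfolding decomp_def outer_def by auto
qed

lemma conj_diag_index:
  assumes "U \<in> carrier_mat N N" "i < N" "j < N"
  shows "(U * mat_diag N (\<lambda>i. of_real (a i)) * mat_adjoint U) $$ (i, j)
    = (\<Sum>x<N. of_real (a x) * U $$ (i, x) * cnj (U $$ (j, x)))"
proof -
  have c: "U * mat_diag N (\<lambda>i. complex_of_real (a i)) \<in> carrier_mat N N" using assms(1) by simp
  show ?thesis
    unfolding times_mat_index[OF c mat_adjoint_carrier[OF assms(1)] assms(2,3)]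
    using assms by (intro sum.cong) (auto simp: mat_adjoint_index[OF assms(1)] mat_diag_mult_right[OF assms(1)])
qed

lemma decomp_iff_unitary:
  assumes "U \<in> carrier_mat N N"
  shows "decomp N A (\<lambda>x i. U $$ (i, x)) a \<longleftrightarrow>
    unitary_mat N U \<and> A = U * mat_diag N (\<lambda>i. of_real (a i)) * mat_adjoint U"
proof -
  have c: "U * mat_diag N (\<lambda>i. complex_of_real (a i)) * mat_adjoint U \<in> carrier_mat N N"
    by (intro mult_carrier_mat[of _ N N] assms mat_adjoint_carrier) simp_all
  have "outer N A {..<N} a (\<lambda>x i. U $$ (i, x)) \<longleftrightarrow> A = U * mat_diag N (\<lambda>i. of_real (a i)) * mat_adjoint U"
    (is "?l \<longleftrightarrow> A = ?r")
  proof
    assume ?l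
    note A = outerD(1)[OF \<open>?l\<close>]
    show "A = ?r"
    proof (rule eq_matI)
      show "dim_row A = dim_row ?r" "dim_col A = dim_col ?r"
        unfolding carrier_matD[OF A] carrier_matD[OF c] by (rule refl)+
      fix i j assume "i < dim_row ?r" "j < dim_col ?r"
      then have ij: "i < N" "j < N" unfolding carrier_matD[OF c] .
      show "A $$ (i, j) = ?r $$ (i, j)"
        unfolding outerD(2)[OF \<open>?l\<close> ij] conj_diag_index[OF assms ij] by (rule refl)
    qed
  next
    assume "A = ?r"
    then show ?l using c conj_diag_index[OF assms, of _ _ a] unfolding outer_def by auto
  qed
  then show ?thesis unfolding decomp_def unitary_mat_iff[OF assms] by blast
qed

lemma decomp_cong:
  assumes "\<And>x i. x < N \<Longrightarrow> i < N \<Longrightarrow> u x i = u' x i"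
  shows "decomp N A u a \<longleftrightarrow> decomp N A u' a"
proof -
  have "iprod N (u x) (u y) = iprod N (u' x) (u' y)" if "x < N" "y < N" for x y
    using assms that by (intro iprod_cong) auto
  then show ?thesis using assms unfolding decomp_def orthonormal_def outer_def by auto
qed

text \<open>The given decomposition shows that the choice in \<open>herm_fun\<close> is made from a
  nonempty set; whichever decomposition is chosen, \<open>decomp_unique\<close> carries the result
  back to \<open>u\<close>.\<close>

lemma herm_fun_decomp:
  assumes "decomp N A u a"
  shows "decomp N (herm_fun f A) u (\<lambda>x. f (a x))"
proof -
  have dim: "dim_row A = N" using assms outerD(1) unfolding decomp_def by blast
  define Q where "Q B \<longleftrightarrow> (\<exists>U b. unitary_mat N U \<and>
     A = U * mat_diag N (\<lambda>i. complex_of_real (b i)) * mat_adjoint U \<and>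
     B = U * mat_diag N (\<lambda>i. complex_of_real (f (b i))) * mat_adjoint U)" for B
  let ?U = "mat N N (\<lambda>(i, x). u x i)"
  have "decomp N A (\<lambda>x i. ?U $$ (i, x)) a"
    using assms by (subst decomp_cong[where u' = u]) auto
  then have "unitary_mat N ?U \<and> A = ?U * mat_diag N (\<lambda>i. of_real (a i)) * mat_adjoint ?U"
    by (subst (asm) decomp_iff_unitary) auto
  then have "Q (?U * mat_diag N (\<lambda>i. complex_of_real (f (a i))) * mat_adjoint ?U)"
    unfolding Q_def by blast
  then have "Q (SOME B. Q B)" by (rule someI)
  also have "(SOME B. Q B) = herm_fun f A" unfolding herm_fun_def Q_def dim ..
  finally obtain U b where U: "unitary_mat N U"
    "A = U * mat_diag N (\<lambda>i. complex_of_real (b i)) * mat_adjoint U"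
    "herm_fun f A = U * mat_diag N (\<lambda>i. complex_of_real (f (b i))) * mat_adjoint U"
    unfolding Q_def by blast
  have Uc: "U \<in> carrier_mat N N" using U(1) unfolding unitary_mat_def by simp
  show ?thesis
    using decomp_unique[OF assms, of "\<lambda>x i. U $$ (i, x)" b "herm_fun f A" f] U
    unfolding decomp_iff_unitary[OF Uc] by blast
qed

section \<open>Spectral formulas for trace, trace norm and entropy, and bounds on the trace
  norm\<close>

lemma decomp_times:
  assumes "decomp N A u a" "decomp N B u b"
  shows "decomp N (A * B) u (\<lambda>x. a x * b x)"
proof -
  have Ao: "outer N A {..<N} a u" and Bo: "outer N B {..<N} b u" and o: "orthonormal N {..<N} u"
    using assms unfolding decomp_def by auto
  note c = outerD(1)[OF Ao] outerD(1)[OF Bo]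
  have "(A * B) $$ (i, j) = (\<Sum>x<N. of_real (a x * b x) * u x i * cnj (u x j))" if ij: "i < N" "j < N" for i j
  proof -
    have "(A * B) $$ (i, j) = (\<Sum>l<N. A $$ (i, l) * (\<Sum>x<N. of_real (b x) * u x l * cnj (u x j)))"
      unfolding times_mat_index[OF c ij] using outerD(2)[OF Bo _ ij(2)] by simp
    also have "\<dots> = (\<Sum>l<N. \<Sum>x<N. of_real (b x) * (A $$ (i, l) * u x l) * cnj (u x j))"
      by (simp add: sum_distrib_left mult_ac)
    also have "\<dots> = (\<Sum>x<N. \<Sum>l<N. of_real (b x) * (A $$ (i, l) * u x l) * cnj (u x j))"
      by (rule sum.swap)
    also have "\<dots> = (\<Sum>x<N. of_real (b x) * matvec N (\<lambda>i j. A $$ (i, j)) (u x) i * cnj (u x j))"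
      by (simp add: matvec_def sum_distrib_left sum_distrib_right)
    also have "\<dots> = (\<Sum>x<N. of_real (a x * b x) * u x i * cnj (u x j))"
      using decomp_matvec[OF assms(1)] ij by (intro sum.cong) auto
    finally show ?thesis .
  qed
  then show ?thesis using o c unfolding decomp_def outer_def by auto
qed

lemma outer_trace:
  assumes "outer N A Z w h"
  shows "mat_trace A = of_real (\<Sum>z\<in>Z. w z * norm_sq N (h z))"
proof -
  have "mat_trace A = (\<Sum>i<N. \<Sum>z\<in>Z. of_real (w z) * h z i * cnj (h z i))"
    unfolding mat_trace_def using outerD[OF assms] by auto
  also have "\<dots> = (\<Sum>z\<in>Z. of_real (w z) * iprod N (h z) (h z))"
    by (subst sum.swap) (simp add: iprod_def sum_distrib_left mult.assoc)
  finally show ?thesis by (simp add: iprod_self)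
qed

lemma decomp_trace:
  assumes "decomp N A u a"
  shows "mat_trace A = of_real (\<Sum>x<N. a x)"
  using assms outer_trace[of N A "{..<N}" a u] orthonormal_norm_sq[of N "{..<N}" u]
  unfolding decomp_def by simp

text \<open>A matrix with a decomposition is Hermitian, so \<open>mat_adjoint A * A\<close> is its
  square, with eigenvalues \<open>a x * a x\<close>.\<close>

lemma trace_norm_decomp:
  assumes "decomp N A u a"
  shows "trace_norm A = (\<Sum>x<N. \<bar>a x\<bar>)"
proof -
  have "mat_adjoint A = A" using assms outer_herm unfolding decomp_def by blast
  then have "decomp N (herm_fun sqrt (mat_adjoint A * A)) u (\<lambda>x. sqrt (a x * a x))"
    using herm_fun_decomp[OF decomp_times[OF assms assms]] by (simp only:)
  from decomp_trace[OF this] show ?thesis unfolding trace_norm_def by simp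
qed

lemma vn_entropy_decomp:
  assumes "decomp N A u a"
  shows "vn_entropy A = - (\<Sum>x<N. a x * log 2 (a x))"
  unfolding vn_entropy_def
  using decomp_trace[OF decomp_times[OF assms herm_fun_decomp[OF assms]]] by simp

lemma decomp_eigenvalue:
  assumes "decomp N A u a" "x < N"
  shows "iprod N (matvec N (\<lambda>i j. A $$ (i, j)) (u x)) (u x) = of_real (a x)"
proof -
  have "iprod N (matvec N (\<lambda>i j. A $$ (i, j)) (u x)) (u x) = iprod N (\<lambda>i. of_real (a x) * u x i) (u x)"
    using decomp_matvec[OF assms] by (intro iprod_cong) auto
  also have "\<dots> = of_real (a x)"
    using assms orthonormalD[of N "{..<N}" u x x] unfolding decomp_def by (simp add: iprod_scale_left)
  finally show ?thesis .
qed

lemma density_decomp: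
  assumes "density_mat d \<rho>"
  shows "\<exists>u p. decomp d \<rho> u p \<and> (\<forall>x<d. 0 \<le> p x) \<and> (\<Sum>x<d. p x) = 1"
proof -
  have psd: "\<rho> \<in> carrier_mat d d" "mat_adjoint \<rho> = \<rho>"
    "\<And>v. v \<in> carrier_vec d \<Longrightarrow> 0 \<le> Re ((\<rho> *\<^sub>v v) \<bullet>c v)" and tr: "mat_trace \<rho> = 1"
    using assms unfolding density_mat_def psd_mat_def by auto
  obtain u p where u: "decomp d \<rho> u p" using herm_decomp[OF psd(1,2)] by auto
  \<comment> \<open>Positivity is tested on the eigenvector itself.\<close>
  have "0 \<le> p x" if "x < d" for x
  proof -
    have "(\<rho> *\<^sub>v vec d (u x)) \<bullet>c vec d (u x) = iprod d (matvec d (\<lambda>i j. \<rho> $$ (i, j)) (u x)) (u x)"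
      using psd(1) unfolding iprod_def matvec_def
      by (auto simp: scalar_prod_def lessThan_atLeast0 conjugate_complex_def intro!: sum.cong)
    then show ?thesis using psd(3)[of "vec d (u x)"] decomp_eigenvalue[OF u that] by simp
  qed
  moreover have "(\<Sum>x<d. p x) = 1" using decomp_trace[OF u] tr of_real_eq_1_iff by metis
  ultimately show ?thesis using u by blast
qed

text \<open>A triangle inequality: each eigenvalue is the quadratic form at its eigenvector, hence a
  combination of the \<open>w z\<close>. Moduli are summed over the eigenbasis, and Bessel's
  inequality is applied to each \<open>h z\<close>.\<close>

lemma trace_norm_le:
  assumes "outer N A Z w h" "finite Z"
  shows "trace_norm A \<le> (\<Sum>z\<in>Z. \<bar>w z\<bar> * norm_sq N (h z))"
proof -
  obtain u a where u: "decomp N A u a" using outer_decomp[OF assms(1)] by auto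
  have o: "orthonormal N {..<N} u" using u unfolding decomp_def by auto
  have "\<bar>a x\<bar> \<le> (\<Sum>z\<in>Z. \<bar>w z\<bar> * (cmod (iprod N (u x) (h z)))\<^sup>2)" if "x < N" for x
  proof -
    have "a x = (\<Sum>z\<in>Z. w z * (cmod (iprod N (u x) (h z)))\<^sup>2)"
      using decomp_eigenvalue[OF u that] outer_quad[OF assms(1), of "u x"] of_real_eq_iff by metis
    also have "\<bar>\<dots>\<bar> \<le> (\<Sum>z\<in>Z. \<bar>w z * (cmod (iprod N (u x) (h z)))\<^sup>2\<bar>)" by (rule sum_abs)
    finally show ?thesis by (simp add: abs_mult)
  qed
  then have "trace_norm A \<le> (\<Sum>x<N. \<Sum>z\<in>Z. \<bar>w z\<bar> * (cmod (iprod N (u x) (h z)))\<^sup>2)"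
    unfolding trace_norm_decomp[OF u] by (intro sum_mono) auto
  also have "\<dots> = (\<Sum>z\<in>Z. \<bar>w z\<bar> * (\<Sum>x<N. (cmod (iprod N (u x) (h z)))\<^sup>2))"
    by (subst sum.swap) (simp add: sum_distrib_left)
  also have "\<dots> \<le> (\<Sum>z\<in>Z. \<bar>w z\<bar> * norm_sq N (h z))"
    using bessel'[OF o] by (intro sum_mono mult_left_mono) auto
  finally show ?thesis .
qed

text \<open>The left side is the trace of \<open>A\<close> compressed to the span of the
  \<open>v r\<close>. In the eigenbasis it combines the eigenvalues with coefficients in [0, 1],
  hence is at most the sum of their moduli.\<close>

lemma trace_norm_ge:
  assumes "outer N A Z w h" "orthonormal N R v" "finite R"
  shows "(\<Sum>r\<in>R. \<Sum>z\<in>Z. w z * (cmod (iprod N (v r) (h z)))\<^sup>2) \<le> trace_norm A"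
proof -
  obtain u a where u: "decomp N A u a" using outer_decomp[OF assms(1)] by auto
  have o: "orthonormal N {..<N} u" and Ao: "outer N A {..<N} a u" using u unfolding decomp_def by auto
  have "(\<Sum>z\<in>Z. w z * (cmod (iprod N (v r) (h z)))\<^sup>2) = (\<Sum>x<N. a x * (cmod (iprod N (v r) (u x)))\<^sup>2)" for r
    using outer_quad[OF assms(1), of "v r"] outer_quad[OF Ao, of "v r"] of_real_eq_iff by metis
  then have "(\<Sum>r\<in>R. \<Sum>z\<in>Z. w z * (cmod (iprod N (v r) (h z)))\<^sup>2)
      = (\<Sum>x<N. a x * (\<Sum>r\<in>R. (cmod (iprod N (v r) (u x)))\<^sup>2))"
    by simp (subst sum.swap, simp add: sum_distrib_left)
  also have "\<dots> \<le> (\<Sum>x<N. \<bar>a x\<bar> * 1)"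
  proof (rule sum_mono)
    fix x assume "x \<in> {..<N}"
    then have "(\<Sum>r\<in>R. (cmod (iprod N (v r) (u x)))\<^sup>2) \<le> 1"
      using bessel'[OF assms(2,3), of "u x"] orthonormal_norm_sq[OF o] by simp
    moreover have "0 \<le> (\<Sum>r\<in>R. (cmod (iprod N (v r) (u x)))\<^sup>2)" by (simp add: sum_nonneg)
    ultimately show "a x * (\<Sum>r\<in>R. (cmod (iprod N (v r) (u x)))\<^sup>2) \<le> \<bar>a x\<bar> * 1"
      by (intro mult_mono) auto
  qed
  finally show ?thesis using trace_norm_decomp[OF u] by simp
qed

lemma outer_minus:
  assumes "outer N A Z w h" "outer N B Z' w' h'" "finite Z" "finite Z'"
  shows "outer N (A - B) (Z <+> Z') (case_sum w (\<lambda>z. - w' z)) (case_sum h h')"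
  using outerD[OF assms(1)] outerD[OF assms(2)] assms(3,4)
  unfolding outer_def by (auto simp: sum.Plus sum_negf)

section \<open>Tensor powers and protocol outputs\<close>

lemma sum_mult_blocks: "(\<Sum>i<a * b. G i) = (\<Sum>i<a. \<Sum>j<b. G (i * b + j))" for a b :: nat
proof -
  have "sum G {i * b..<i * b + b} = (\<Sum>j<b. G (i * b + j))" for i
    using sum.shift_bounds_nat_ivl[of G 0 "i * b" b] by (simp add: lessThan_atLeast0 add.commute)
  then show ?thesis using sum.nat_group[of G b a] by simp
qed

lemma sum_div_mod: "(\<Sum>i<a * b. F (i div b) (i mod b)) = (\<Sum>i<a. \<Sum>j<b. F i j)" for a b :: nat
  unfolding sum_mult_blocks by (intro sum.cong refl) auto

lemma div_mod_bounds: "i < a * b \<Longrightarrow> i div b < a" "i < a * b \<Longrightarrow> i mod b < b" for a b i :: nat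
  by (metis less_mult_imp_div_less) (metis mod_less_divisor mult_0_right not_gr_zero not_less_zero)

lemma iprod_blocks: "iprod (a * b) u v = (\<Sum>l<b. iprod a (\<lambda>i. u (i * b + l)) (\<lambda>i. v (i * b + l)))"
  unfolding iprod_def sum_mult_blocks by (rule sum.swap)

lemma norm_sq_blocks: "norm_sq (a * b) u = (\<Sum>l<b. norm_sq a (\<lambda>i. u (i * b + l)))"
  unfolding norm_sq_def sum_mult_blocks by (rule sum.swap)

lemma iprod_prod:
  "iprod (a * b) (\<lambda>i. u (i div b) * v (i mod b)) (\<lambda>i. u' (i div b) * v' (i mod b)) = iprod a u u' * iprod b v v'"
proof -
  have "iprod (a * b) (\<lambda>i. u (i div b) * v (i mod b)) (\<lambda>i. u' (i div b) * v' (i mod b))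
      = (\<Sum>i<a. \<Sum>j<b. u i * v j * cnj (u' i * v' j))"
    unfolding iprod_def by (rule sum_div_mod[of "\<lambda>i j. u i * v j * cnj (u' i * v' j)"])
  also have "\<dots> = iprod a u u' * iprod b v v'"
    unfolding iprod_def by (simp add: sum_product mult_ac)
  finally show ?thesis .
qed

lemma kron_carrier: "A \<in> carrier_mat a a \<Longrightarrow> B \<in> carrier_mat b b \<Longrightarrow> kron A B \<in> carrier_mat (a * b) (a * b)"
  unfolding kron_def by auto

lemma kron_index:
  assumes "A \<in> carrier_mat a a" "B \<in> carrier_mat b b" "i < a * b" "j < a * b"
  shows "kron A B $$ (i, j) = A $$ (i div b, j div b) * B $$ (i mod b, j mod b)"
  using assms unfolding kron_def by auto

lemma kron_decomp:
  assumes "decomp a A u p" "decomp b B v q"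
  shows "decomp (a * b) (kron A B) (\<lambda>x i. u (x div b) (i div b) * v (x mod b) (i mod b))
    (\<lambda>x. p (x div b) * q (x mod b))"
proof -
  have Ao: "outer a A {..<a} p u" and Bo: "outer b B {..<b} q v"
    and o: "orthonormal a {..<a} u" "orthonormal b {..<b} v"
    using assms unfolding decomp_def by auto
  note c = outerD(1)[OF Ao] outerD(1)[OF Bo]
  have "orthonormal (a * b) {..<a * b} (\<lambda>x i. u (x div b) (i div b) * v (x mod b) (i mod b))"
    unfolding orthonormal_def
  proof (intro ballI)
    fix x y assume "x \<in> {..<a * b}" "y \<in> {..<a * b}"
    moreover have "x = y \<longleftrightarrow> x div b = y div b \<and> x mod b = y mod b"
      by (metis div_mult_mod_eq)
    ultimately show "iprod (a * b) (\<lambda>i. u (x div b) (i div b) * v (x mod b) (i mod b))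
        (\<lambda>i. u (y div b) (i div b) * v (y mod b) (i mod b)) = (if x = y then 1 else 0)"
      unfolding iprod_prod using orthonormalD[OF o(1)] orthonormalD[OF o(2)]
      by (auto simp: div_mod_bounds)
  qed
  moreover have "kron A B $$ (i, j) = (\<Sum>x<a * b. of_real (p (x div b) * q (x mod b)) *
      (u (x div b) (i div b) * v (x mod b) (i mod b)) * cnj (u (x div b) (j div b) * v (x mod b) (j mod b)))"
    if ij: "i < a * b" "j < a * b" for i j
  proof -
    have "kron A B $$ (i, j) = (\<Sum>x<a. of_real (p x) * u x (i div b) * cnj (u x (j div b))) *
        (\<Sum>y<b. of_real (q y) * v y (i mod b) * cnj (v y (j mod b)))"
      unfolding kron_index[OF c ij] using outerD(2)[OF Ao] outerD(2)[OF Bo] ij by (simp add: div_mod_bounds)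
    also have "\<dots> = (\<Sum>x<a. \<Sum>y<b. of_real (p x * q y) *
      (u x (i div b) * v y (i mod b)) * cnj (u x (j div b) * v y (j mod b)))"
      by (simp add: sum_product mult_ac)
    finally show ?thesis
      unfolding sum_div_mod[of "\<lambda>x y. of_real (p x * q y) *
      (u x (i div b) * v y (i mod b)) * cnj (u x (j div b) * v y (j mod b))"] .
  qed
  ultimately show ?thesis using kron_carrier[OF c] unfolding decomp_def outer_def by auto
qed

text \<open>An index below \<open>d ^ n\<close> is read as a word of \<open>n\<close> digits in base
  \<open>d\<close>, most significant digit first as in \<open>kron\<close>; the weight is the
  product of the probabilities of the digits.\<close>

primrec tensor_weight :: "(nat \<Rightarrow> real) \<Rightarrow> nat \<Rightarrow> nat \<Rightarrow> nat \<Rightarrow> real" where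
  "tensor_weight p d 0 x = 1"
| "tensor_weight p d (Suc n) x = p (x div d ^ n) * tensor_weight p d n (x mod d ^ n)"

primrec tensor_vec :: "(nat \<Rightarrow> nat \<Rightarrow> complex) \<Rightarrow> nat \<Rightarrow> nat \<Rightarrow> nat \<Rightarrow> nat \<Rightarrow> complex" where
  "tensor_vec u d 0 x i = 1"
| "tensor_vec u d (Suc n) x i = u (x div d ^ n) (i div d ^ n) * tensor_vec u d n (x mod d ^ n) (i mod d ^ n)"

lemma tensor_power_decomp:
  assumes "decomp d \<rho> u p"
  shows "decomp (d ^ n) (tensor_power \<rho> n) (tensor_vec u d n) (tensor_weight p d n)"
proof (induction n)
  case 0
  show ?case by (simp add: decomp_def outer_def orthonormal_def iprod_def)
next
  case (Suc n)
  have "tensor_vec u d (Suc n) = (\<lambda>x i. u (x div d ^ n) (i div d ^ n) * tensor_vec u d n (x mod d ^ n) (i mod d ^ n))"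
    "tensor_weight p d (Suc n) = (\<lambda>x. p (x div d ^ n) * tensor_weight p d n (x mod d ^ n))"
    by (auto simp: fun_eq_iff)
  then show ?case using kron_decomp[OF assms Suc] by simp
qed

lemma copy_dim_le:
  assumes "dim_row \<rho> = d" "0 < d"
  shows "d ^ n \<le> 2 ^ copy_qubits \<rho> n"
proof -
  have "real n * log 2 (real d) \<le> real (copy_qubits \<rho> n)"
    unfolding copy_qubits_def qubits_def assms(1) by linarith
  then have "2 powr (real n * log 2 (real d)) \<le> 2 powr real (copy_qubits \<rho> n)" by simp
  moreover have "2 powr (real n * log 2 (real d)) = real (d ^ n)"
  proof -
    have "2 powr (real n * log 2 (real d)) = (2 powr log 2 (real d)) powr real n"
      by (simp add: powr_powr mult.commute)
    also have "\<dots> = real (d ^ n)" using assms(2) by (simp add: powr_realpow)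
    finally show ?thesis .
  qed
  ultimately show ?thesis by (simp add: powr_realpow flip: of_nat_le_iff[where 'a = real])
qed

text \<open>Embedding of the \<open>d ^ n\<close>-dimensional space of the copies into the register
  of whole qubits, matching the zero entries in \<open>copies\<close>.\<close>

definition pad :: "nat \<Rightarrow> (nat \<Rightarrow> complex) \<Rightarrow> nat \<Rightarrow> complex" where
  "pad m v i = (if i < m then v i else 0)"

lemma iprod_pad: "m \<le> N \<Longrightarrow> iprod N (pad m u) (pad m v) = iprod m u v"
  unfolding iprod_def pad_def
  by (rule sum.mono_neutral_cong_right) auto

lemma copies_outer:
  assumes "decomp d \<rho> u p" "0 < d"
  shows "orthonormal (2 ^ copy_qubits \<rho> n) {..<d ^ n} (\<lambda>x. pad (d ^ n) (tensor_vec u d n x))"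
    and "outer (2 ^ copy_qubits \<rho> n) (copies \<rho> n) {..<d ^ n} (tensor_weight p d n)
      (\<lambda>x. pad (d ^ n) (tensor_vec u d n x))"
proof -
  have dim: "dim_row \<rho> = d" using assms(1) outerD(1) unfolding decomp_def by blast
  note le = copy_dim_le[OF dim assms(2), of n]
  have o: "orthonormal (d ^ n) {..<d ^ n} (tensor_vec u d n)"
    and T: "outer (d ^ n) (tensor_power \<rho> n) {..<d ^ n} (tensor_weight p d n) (tensor_vec u d n)"
    using tensor_power_decomp[OF assms(1), of n] unfolding decomp_def by auto
  show "orthonormal (2 ^ copy_qubits \<rho> n) {..<d ^ n} (\<lambda>x. pad (d ^ n) (tensor_vec u d n x))"
    using o unfolding orthonormal_def iprod_pad[OF le] .
  show "outer (2 ^ copy_qubits \<rho> n) (copies \<rho> n) {..<d ^ n} (tensor_weight p d n)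
      (\<lambda>x. pad (d ^ n) (tensor_vec u d n x))"
    unfolding outer_def copies_def dim using outerD(2)[OF T] by (auto simp: pad_def)
qed

text \<open>Tensoring with a fixed unit vector is isometric, so pure ancillas change neither the
  weights nor the orthonormality.\<close>

lemma kron_projector_outer:
  assumes A: "outer a A Z w h" and "orthonormal a Z h"
    and \<psi>: "\<psi> \<in> carrier_vec b" "\<psi> \<bullet>c \<psi> = 1"
  shows "orthonormal (a * b) Z (\<lambda>z i. h z (i div b) * \<psi> $ (i mod b))"
    and "outer (a * b) (kron A (projector \<psi>)) Z w (\<lambda>z i. h z (i div b) * \<psi> $ (i mod b))"
proof -
  have "iprod b (\<lambda>i. \<psi> $ i) (\<lambda>i. \<psi> $ i) = 1"
    using \<psi> unfolding iprod_def by (auto simp: scalar_prod_def lessThan_atLeast0 conjugate_complex_def)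
  then show "orthonormal (a * b) Z (\<lambda>z i. h z (i div b) * \<psi> $ (i mod b))"
    using assms(2) unfolding orthonormal_def by (simp add: iprod_prod)
  have P: "projector \<psi> \<in> carrier_mat b b" using \<psi>(1) unfolding projector_def by auto
  have "kron A (projector \<psi>) $$ (i, j) = (\<Sum>z\<in>Z. of_real (w z) * (h z (i div b) * \<psi> $ (i mod b)) *
      cnj (h z (j div b) * \<psi> $ (j mod b)))" if "i < a * b" "j < a * b" for i j
  proof -
    note b = div_mod_bounds[OF that(1)] div_mod_bounds[OF that(2)]
    have "projector \<psi> $$ (i mod b, j mod b) = \<psi> $ (i mod b) * cnj (\<psi> $ (j mod b))"
      using \<psi>(1) b unfolding projector_def by auto
    then show ?thesis
      unfolding kron_index[OF outerD(1)[OF A] P that]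
      using b by (simp add: outerD(2)[OF A] sum_distrib_left sum_distrib_right mult_ac)
  qed
  then show "outer (a * b) (kron A (projector \<psi>)) Z w (\<lambda>z i. h z (i div b) * \<psi> $ (i mod b))"
    using kron_carrier[OF outerD(1)[OF A] P] unfolding outer_def by blast
qed

section \<open>Unitary conjugation, partial trace and unitaries with prescribed values\<close>

lemma conj_outer:
  assumes A: "outer N A Z w h" and U: "U \<in> carrier_mat N N"
  shows "outer N (U * A * mat_adjoint U) Z w (\<lambda>z. matvec N (\<lambda>i j. U $$ (i, j)) (h z))"
proof -
  note c = outerD(1)[OF A] mat_adjoint_carrier[OF U]
  have UA: "U * A \<in> carrier_mat N N" using U c by simp
  have "(U * A * mat_adjoint U) $$ (i, j) = (\<Sum>z\<in>Z. of_real (w z) *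
      matvec N (\<lambda>i j. U $$ (i, j)) (h z) i * cnj (matvec N (\<lambda>i j. U $$ (i, j)) (h z) j))"
    if ij: "i < N" "j < N" for i j
  proof -
    have UAi: "(U * A) $$ (i, l) = (\<Sum>z\<in>Z. of_real (w z) * matvec N (\<lambda>i j. U $$ (i, j)) (h z) i * cnj (h z l))"
      if l: "l < N" for l
    proof -
      have "(U * A) $$ (i, l) = (\<Sum>k<N. \<Sum>z\<in>Z. of_real (w z) * (U $$ (i, k) * h z k) * cnj (h z l))"
        unfolding times_mat_index[OF U c(1) ij(1) l] using outerD(2)[OF A _ l]
        by (simp add: sum_distrib_left mult_ac)
      also have "\<dots> = (\<Sum>z\<in>Z. \<Sum>k<N. of_real (w z) * (U $$ (i, k) * h z k) * cnj (h z l))"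
        by (rule sum.swap)
      finally show ?thesis by (simp add: matvec_def sum_distrib_left sum_distrib_right)
    qed
    have "(U * A * mat_adjoint U) $$ (i, j) = (\<Sum>l<N. \<Sum>z\<in>Z. of_real (w z) *
        matvec N (\<lambda>i j. U $$ (i, j)) (h z) i * cnj (U $$ (j, l) * h z l))"
      unfolding times_mat_index[OF UA c(2) ij]
      using UAi ij by (simp add: mat_adjoint_index[OF U] sum_distrib_left sum_distrib_right mult_ac)
    also have "\<dots> = (\<Sum>z\<in>Z. \<Sum>l<N. of_real (w z) *
        matvec N (\<lambda>i j. U $$ (i, j)) (h z) i * cnj (U $$ (j, l) * h z l))"
      by (rule sum.swap)
    also have "\<dots> = (\<Sum>z\<in>Z. of_real (w z) *
      matvec N (\<lambda>i j. U $$ (i, j)) (h z) i * cnj (matvec N (\<lambda>i j. U $$ (i, j)) (h z) j))"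
      by (intro sum.cong refl) (simp add: matvec_def[of N _ _ j] sum_distrib_left)
    finally show ?thesis .
  qed
  then show ?thesis using UA c unfolding outer_def by auto
qed

lemma unitary_matvec_iprod:
  assumes "unitary_mat N U"
  shows "iprod N (matvec N (\<lambda>i j. U $$ (i, j)) v) (matvec N (\<lambda>i j. U $$ (i, j)) w) = iprod N v w"
proof -
  have U: "U \<in> carrier_mat N N" using assms unfolding unitary_mat_def by simp
  have o: "orthonormal N {..<N} (\<lambda>x i. U $$ (i, x))" using assms unitary_mat_iff[OF U] by simp
  have "iprod N (matvec N (\<lambda>i j. U $$ (i, j)) v) (matvec N (\<lambda>i j. U $$ (i, j)) w)
      = iprod N (\<lambda>i. \<Sum>j<N. v j * U $$ (i, j)) (\<lambda>i. \<Sum>j<N. w j * U $$ (i, j))"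
    unfolding matvec_def[abs_def] by (simp add: mult.commute)
  also have "\<dots> = (\<Sum>j<N. v j * (\<Sum>k<N. cnj (w k) * (if j = k then 1 else 0)))"
    unfolding iprod_sum_left iprod_sum_right using orthonormalD[OF o] by (intro sum.cong refl) auto
  also have "\<dots> = iprod N v w"
    unfolding iprod_def by (intro sum.cong refl) (simp add: if_distrib[of "\<lambda>z. _ * z"] cong: if_cong)
  finally show ?thesis .
qed

text \<open>Tracing out the second factor cuts each vector into \<open>b\<close> slices, one per
  garbage basis state. The slices need not be normalised; by \<open>norm_sq_blocks\<close> their
  squared norms add up to that of the whole vector.\<close>

lemma partial_trace_outer:
  assumes M: "outer (a * b) M Z w h" and "finite Z"
  shows "outer a (partial_trace a b M) (Z \<times> {..<b}) (\<lambda>(z, l). w z) (\<lambda>(z, l) i. h z (i * b + l))"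
proof -
  have "partial_trace a b M $$ (i, j) =
      (\<Sum>(z, l)\<in>Z \<times> {..<b}. of_real (w z) * h z (i * b + l) * cnj (h z (j * b + l)))"
    if ij: "i < a" "j < a" for i j
  proof -
    have *: "i * b + l < a * b" if "i < a" "l < b" for i l
    proof -
      have "i * b + l < Suc i * b" using that by simp
      also have "\<dots> \<le> a * b" using that by (intro mult_right_mono) auto
      finally show ?thesis .
    qed
    have "partial_trace a b M $$ (i, j) = (\<Sum>l<b. \<Sum>z\<in>Z. of_real (w z) * h z (i * b + l) * cnj (h z (j * b + l)))"
      using ij outerD(2)[OF M] * by (simp add: partial_trace_def)
    also have "\<dots> = (\<Sum>z\<in>Z. \<Sum>l<b. of_real (w z) * h z (i * b + l) * cnj (h z (j * b + l)))"
      by (rule sum.swap)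
    finally show ?thesis using assms(2) by (simp add: sum.cartesian_product)
  qed
  then show ?thesis unfolding outer_def by (auto simp: partial_trace_def case_prod_unfold)
qed

lemma orthonormal_card_le:
  assumes "orthonormal N A u" "finite A"
  shows "card A \<le> N"
proof -
  have "real (card A) = (\<Sum>x\<in>A. norm_sq N (u x))" using orthonormal_norm_sq[OF assms(1)] by simp
  also have "\<dots> = (\<Sum>i<N. \<Sum>x\<in>A. (cmod (iprod N (\<lambda>j. if j = i then 1 else 0) (u x)))\<^sup>2)"
    unfolding norm_sq_def by (subst sum.swap) (simp add: iprod_delta)
  also have "\<dots> \<le> (\<Sum>i<N. norm_sq N (\<lambda>j. if j = i then 1 else 0))"
    by (intro sum_mono bessel[OF assms])
  also have "\<dots> = (\<Sum>i<N. 1)"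
    by (intro sum.cong refl) (simp add: norm_sq_def if_distrib[of cmod] if_distrib[of "\<lambda>z. z\<^sup>2"] cong: if_cong)
  finally show ?thesis by simp
qed

text \<open>Both families are completed to bases \<open>E'\<close> and \<open>F'\<close> of the
  whole space, and \<open>U\<close> is the matrix that sends \<open>E' r\<close> to
  \<open>F' r\<close>.\<close>

lemma exists_unitary_mapping:
  assumes E: "orthonormal N T E" and F: "orthonormal N T F" and "finite T"
  shows "\<exists>U. unitary_mat N U \<and> (\<forall>x\<in>T. \<forall>i<N. matvec N (\<lambda>i j. U $$ (i, j)) (E x) i = F x i)"
proof -
  define m where "m = card T"
  obtain t where t: "bij_betw t {..<m} T"
    using ex_bij_betw_nat_finite[OF assms(3)] unfolding m_def lessThan_atLeast0 by auto
  have m: "m \<le> N" unfolding m_def by (rule orthonormal_card_le[OF E assms(3)])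
  have comp: "orthonormal N {..<m} (\<lambda>r. h (t r))" if "orthonormal N T h" for h
    using that t unfolding orthonormal_def bij_betw_def inj_on_def by (metis imageI)
  obtain E' where E': "orthonormal N {..<N} E'" "\<And>r. r < m \<Longrightarrow> E' r = E (t r)"
    using orthonormal_extend[OF comp[OF E] m] by auto
  obtain F' where F': "orthonormal N {..<N} F'" "\<And>r. r < m \<Longrightarrow> F' r = F (t r)"
    using orthonormal_extend[OF comp[OF F] m] by auto
  define U where "U = mat N N (\<lambda>(i, j). \<Sum>r<N. F' r i * cnj (E' r j))"
  have U: "U \<in> carrier_mat N N" unfolding U_def by simp
  have Uv: "matvec N (\<lambda>i j. U $$ (i, j)) v i = (\<Sum>r<N. iprod N v (E' r) * F' r i)" if "i < N" for v i
  proof -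
    have "matvec N (\<lambda>i j. U $$ (i, j)) v i = (\<Sum>j<N. \<Sum>r<N. F' r i * cnj (E' r j) * v j)"
      unfolding matvec_def U_def using that by (simp add: sum_distrib_right)
    also have "\<dots> = (\<Sum>r<N. \<Sum>j<N. F' r i * cnj (E' r j) * v j)" by (rule sum.swap)
    also have "\<dots> = (\<Sum>r<N. iprod N v (E' r) * F' r i)"
      by (simp add: iprod_def sum_distrib_left sum_distrib_right mult_ac)
    finally show ?thesis .
  qed
  have "iprod N (\<lambda>i. U $$ (i, x)) (\<lambda>i. U $$ (i, y)) = (if x = y then 1 else 0)" if xy: "x < N" "y < N" for x y
  proof -
    have "iprod N (\<lambda>i. U $$ (i, x)) (\<lambda>i. U $$ (i, y))
        = iprod N (\<lambda>i. \<Sum>r<N. cnj (E' r x) * F' r i) (\<lambda>i. \<Sum>r<N. cnj (E' r y) * F' r i)"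
      unfolding U_def using xy by (intro iprod_cong) (auto simp: mult.commute)
    also have "\<dots> = (\<Sum>r<N. cnj (E' r x) * (\<Sum>s<N. E' s y * (if r = s then 1 else 0)))"
      unfolding iprod_sum_left iprod_sum_right using orthonormalD[OF F'(1)] by (intro sum.cong refl) auto
    also have "\<dots> = (\<Sum>r<N. E' r y * cnj (E' r x))"
    proof (intro sum.cong refl)
      fix r assume "r \<in> {..<N}"
      then have "(\<Sum>s<N. E' s y * (if r = s then 1 else 0)) = E' r y"
        by (simp add: if_distrib[of "\<lambda>z. _ * z"] cong: if_cong)
      then show "cnj (E' r x) * (\<Sum>s<N. E' s y * (if r = s then 1 else 0)) = E' r y * cnj (E' r x)"
        by (simp only: mult.commute)
    qed
    finally show ?thesis using onb_complete[OF E'(1) xy(2,1)] by auto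
  qed
  then have "unitary_mat N U" unfolding unitary_mat_iff[OF U] orthonormal_def by auto
  moreover have "matvec N (\<lambda>i j. U $$ (i, j)) (E x) i = F x i" if "x \<in> T" "i < N" for x i
  proof -
    obtain r where r: "r < m" "x = t r" using t \<open>x \<in> T\<close> unfolding bij_betw_def by auto
    have "matvec N (\<lambda>i j. U $$ (i, j)) (E x) i = (\<Sum>s<N. iprod N (E' r) (E' s) * F' s i)"
      unfolding Uv[OF that(2)] using E'(2) r by simp
    also have "\<dots> = (\<Sum>s<N. if r = s then F' s i else 0)"
      using orthonormalD[OF E'(1)] r(1) m by (intro sum.cong) auto
    finally show ?thesis using r m F'(2) by simp
  qed
  ultimately show ?thesis by blast
qed

section \<open>Typical sets\<close>

text \<open>Additive counterpart of \<open>tensor_weight\<close>: under the product distribution on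
  words it is a sum of \<open>n\<close> independent copies of \<open>h\<close>.\<close>

primrec tensor_sum :: "(nat \<Rightarrow> real) \<Rightarrow> nat \<Rightarrow> nat \<Rightarrow> nat \<Rightarrow> real" where
  "tensor_sum h d 0 x = 0"
| "tensor_sum h d (Suc n) x = h (x div d ^ n) + tensor_sum h d n (x mod d ^ n)"

lemma tensor_weight_nonneg:
  assumes "\<And>x. x < d \<Longrightarrow> 0 \<le> p x" "x < d ^ n"
  shows "0 \<le> tensor_weight p d n x"
  using assms(2)
  by (induction n arbitrary: x) (auto intro!: mult_nonneg_nonneg assms(1) simp: div_mod_bounds)

lemma sum_tensor_weight:
  assumes "(\<Sum>x<d. p x) = 1"
  shows "(\<Sum>x<d ^ n. tensor_weight p d n x) = 1"
proof (induction n)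
  case (Suc n)
  have "(\<Sum>x<d ^ Suc n. tensor_weight p d (Suc n) x) = (\<Sum>i<d. \<Sum>j<d ^ n. p i * tensor_weight p d n j)"
    using sum_div_mod[where F = "\<lambda>i j. p i * tensor_weight p d n j" and a = d and b = "d ^ n"] by simp
  then show ?case using assms Suc by (simp flip: sum_distrib_left)
qed simp

lemma tensor_sum_mean:
  assumes "(\<Sum>x<d. p x) = 1" "(\<Sum>x<d. p x * h x) = 0"
  shows "(\<Sum>x<d ^ n. tensor_weight p d n x * tensor_sum h d n x) = 0"
proof (induction n)
  case (Suc n)
  let ?w = "tensor_weight p d n" and ?s = "tensor_sum h d n"
  have "(\<Sum>x<d ^ Suc n. tensor_weight p d (Suc n) x * tensor_sum h d (Suc n) x)
      = (\<Sum>i<d. \<Sum>j<d ^ n. p i * ?w j * (h i + ?s j))"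
    using sum_div_mod[where F = "\<lambda>i j. p i * ?w j * (h i + ?s j)" and a = d and b = "d ^ n"] by simp
  also have "\<dots> = (\<Sum>i<d. \<Sum>j<d ^ n. (p i * h i) * ?w j + p i * (?w j * ?s j))"
    by (simp add: algebra_simps)
  also have "\<dots> = 0"
    using Suc assms by (simp add: sum.distrib flip: sum_distrib_left sum_distrib_right)
  finally show ?case .
qed simp

text \<open>Variances of independent centred summands add: the cross term factors into two means,
  which are zero.\<close>

lemma tensor_sum_variance:
  assumes "(\<Sum>x<d. p x) = 1" "(\<Sum>x<d. p x * h x) = 0"
  shows "(\<Sum>x<d ^ n. tensor_weight p d n x * (tensor_sum h d n x)\<^sup>2) = real n * (\<Sum>x<d. p x * (h x)\<^sup>2)"
proof (induction n)
  case (Suc n)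
  let ?w = "tensor_weight p d n" and ?s = "tensor_sum h d n"
  have "(\<Sum>x<d ^ Suc n. tensor_weight p d (Suc n) x * (tensor_sum h d (Suc n) x)\<^sup>2)
      = (\<Sum>i<d. \<Sum>j<d ^ n. p i * ?w j * (h i + ?s j)\<^sup>2)"
    using sum_div_mod[where F = "\<lambda>i j. p i * ?w j * (h i + ?s j)\<^sup>2" and a = d and b = "d ^ n"] by simp
  also have "\<dots> = (\<Sum>i<d. \<Sum>j<d ^ n. (p i * (h i)\<^sup>2) * ?w j + (2 * (p i * h i)) * (?w j * ?s j) + p i * (?w j * (?s j)\<^sup>2))"
    by (simp add: algebra_simps power2_eq_square)
  also have "\<dots> = (\<Sum>x<d. p x * (h x)\<^sup>2) + real n * (\<Sum>x<d. p x * (h x)\<^sup>2)"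
    using Suc assms sum_tensor_weight[OF assms(1), of n] tensor_sum_mean[OF assms, of n]
    by (simp add: sum.distrib flip: sum_distrib_left sum_distrib_right)
  finally show ?case by (simp add: algebra_simps)
qed simp

text \<open>The logarithm turns the product over digits into a sum, recentred by \<open>S\<close>
  per digit. A nonzero weight makes every factor positive, so the value \<open>log 2 0 = 0\<close>
  never enters.\<close>

lemma log_tensor_weight:
  assumes "\<And>x. x < d \<Longrightarrow> 0 \<le> p x" "x < d ^ n" "tensor_weight p d n x \<noteq> 0"
  shows "log 2 (tensor_weight p d n x) = - tensor_sum (\<lambda>x. - log 2 (p x) - S) d n x - real n * S"
  using assms(2,3)
proof (induction n arbitrary: x)
  case (Suc n)
  have b: "x div d ^ n < d" "x mod d ^ n < d ^ n" using Suc.prems(1) by (auto simp: div_mod_bounds)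
  have "0 < p (x div d ^ n)" "0 < tensor_weight p d n (x mod d ^ n)"
    using Suc.prems(2) assms(1)[OF b(1)] tensor_weight_nonneg[of d p, OF assms(1) b(2)]
    by (auto simp: less_le)
  then show ?case using Suc.IH[OF b(2)] by (simp add: log_mult algebra_simps)
qed simp

text \<open>Chebyshev's inequality for the logarithm of the weight. The witness for \<open>V\<close>
  is the variance of \<open>- log 2 (p x)\<close> under \<open>p\<close>, whose mean is
  \<open>S\<close>.\<close>

theorem typical_set_exists:
  assumes nonneg: "\<And>x. x < d \<Longrightarrow> 0 \<le> p x" and total: "(\<Sum>x<d. p x) = 1"
    and S: "S = - (\<Sum>x<d. p x * log 2 (p x))"
  shows "\<exists>V\<ge>0. \<forall>n t. 0 < t \<longrightarrow> (\<exists>T\<subseteq>{..<d ^ n}.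
    (\<forall>x\<in>T. 2 powr (- (real n * S) - t) \<le> tensor_weight p d n x \<and>
            tensor_weight p d n x \<le> 2 powr (- (real n * S) + t)) \<and>
    1 - real n * V / t\<^sup>2 \<le> (\<Sum>x\<in>T. tensor_weight p d n x))"
proof (intro exI[of _ "\<Sum>x<d. p x * (- log 2 (p x) - S)\<^sup>2"] conjI allI impI)
  define h where "h x = - log 2 (p x) - S" for x
  show "0 \<le> (\<Sum>x<d. p x * (- log 2 (p x) - S)\<^sup>2)" using nonneg by (intro sum_nonneg) auto
  fix n and t :: real assume t: "0 < t"
  let ?w = "tensor_weight p d n" and ?s = "tensor_sum h d n"
  have mean: "(\<Sum>x<d. p x * h x) = 0"
    using total S by (simp add: h_def right_diff_distrib sum_subtractf sum_negf flip: sum_distrib_right)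
  \<comment> \<open>Words of weight zero are left out because they would violate the lower bound;
    the total weight does not notice.\<close>
  define T where "T = {x\<in>{..<d ^ n}. ?w x \<noteq> 0 \<and> \<bar>?s x\<bar> \<le> t}"
  have w: "0 \<le> ?w x" if "x < d ^ n" for x by (rule tensor_weight_nonneg[OF nonneg that])
  have "2 powr (- (real n * S) - t) \<le> ?w x \<and> ?w x \<le> 2 powr (- (real n * S) + t)" if "x \<in> T" for x
  proof -
    have x: "x < d ^ n" "?w x \<noteq> 0" "\<bar>?s x\<bar> \<le> t" using that unfolding T_def by auto
    then have "log 2 (?w x) = - ?s x - real n * S"
      using log_tensor_weight[OF nonneg x(1,2), of S] unfolding h_def by simp
    moreover have "?w x = 2 powr log 2 (?w x)" using w[OF x(1)] x(2) by simp
    ultimately have "?w x = 2 powr (- ?s x - real n * S)" by simp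
    moreover have "?s x \<le> t" "- ?s x \<le> t" using x(3) by linarith+
    ultimately show ?thesis by simp
  qed
  moreover have "1 - real n * (\<Sum>x<d. p x * (h x)\<^sup>2) / t\<^sup>2 \<le> (\<Sum>x\<in>T. ?w x)"
  proof -
    have "1 = (\<Sum>x\<in>T. ?w x) + (\<Sum>x\<in>{..<d ^ n} - T. ?w x)"
      unfolding sum_tensor_weight[OF total, of n, symmetric]
      by (subst add.commute, rule sum.subset_diff) (auto simp: T_def)
    \<comment> \<open>An atypical word of nonzero weight has \<open>\<bar>?s x\<bar> > t\<close>, so
      its weight may be multiplied by a factor that is at least 1 and whose mean is known.\<close>
    moreover have "(\<Sum>x\<in>{..<d ^ n} - T. ?w x) \<le> (\<Sum>x\<in>{..<d ^ n} - T. ?w x * (?s x)\<^sup>2 / t\<^sup>2)"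
    proof (rule sum_mono)
      fix x assume x: "x \<in> {..<d ^ n} - T"
      show "?w x \<le> ?w x * (?s x)\<^sup>2 / t\<^sup>2"
      proof (cases "?w x = 0")
        case False
        then have "t < \<bar>?s x\<bar>" using x unfolding T_def by auto
        then have "1 \<le> (?s x)\<^sup>2 / t\<^sup>2"
          using t by (simp add: power2_le_iff_abs_le[symmetric] abs_le_square_iff[symmetric])
        then have "?w x * 1 \<le> ?w x * ((?s x)\<^sup>2 / t\<^sup>2)" using w x by (intro mult_left_mono) auto
        then show ?thesis by simp
      qed simp
    qed
    moreover have "\<dots> \<le> (\<Sum>x<d ^ n. ?w x * (?s x)\<^sup>2 / t\<^sup>2)"
      using w by (intro sum_mono2) auto
    moreover have "\<dots> = real n * (\<Sum>x<d. p x * (h x)\<^sup>2) / t\<^sup>2"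
      using tensor_sum_variance[OF total mean, of n] by (simp flip: sum_divide_distrib)
    ultimately show ?thesis by linarith
  qed
  ultimately show "\<exists>T\<subseteq>{..<d ^ n}.
    (\<forall>x\<in>T. 2 powr (- (real n * S) - t) \<le> ?w x \<and> ?w x \<le> 2 powr (- (real n * S) + t)) \<and>
    1 - real n * (\<Sum>x<d. p x * (- log 2 (p x) - S)\<^sup>2) / t\<^sup>2 \<le> (\<Sum>x\<in>T. ?w x)"
    unfolding h_def by (intro exI[of _ T]) (auto simp: T_def)
qed

section \<open>Staircase coupling\<close>

text \<open>Length of the intersection of the intervals from \<open>a\<close> to \<open>b\<close>
  and from \<open>u\<close> to \<open>v\<close>.\<close>

definition overlap :: "real \<Rightarrow> real \<Rightarrow> real \<Rightarrow> real \<Rightarrow> real" where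
  "overlap a b u v = max 0 (min b v - max a u)"

lemma overlap_commute: "overlap a b u v = overlap u v a b"
  unfolding overlap_def by (simp add: min.commute max.commute)

text \<open>Clamping \<open>u\<close> and \<open>v\<close> to the interval from \<open>a\<close> to
  \<open>b\<close> makes the overlap a difference of two values of one function, so that sums over
  consecutive intervals telescope.\<close>

lemma overlap_clamp: "a \<le> b \<Longrightarrow> u \<le> v \<Longrightarrow> overlap a b u v = min (max v a) b - min (max u a) b"
  unfolding overlap_def by (auto simp: min_def max_def)

lemma sum_overlap:
  assumes "a \<le> b" "\<And>s. s < Y \<Longrightarrow> G s \<le> G (Suc s)" "G 0 \<le> a" "b \<le> G Y"
  shows "(\<Sum>s<Y. overlap a b (G s) (G (Suc s))) = b - a"
proof -
  have "(\<Sum>s<Y. overlap a b (G s) (G (Suc s))) = (\<Sum>s<Y. min (max (G (Suc s)) a) b - min (max (G s) a) b)"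
    using assms(1,2) by (intro sum.cong) (auto simp: overlap_clamp)
  also have "\<dots> = min (max (G Y) a) b - min (max (G 0) a) b"
    by (rule sum_lessThan_telescope)
  finally show ?thesis using assms(1,3,4) by (simp add: min_def max_def)
qed

text \<open>An interval that meets the cells \<open>s\<close> and \<open>s'\<close> contains all
  cells between them. If \<open>s + M \<le> s'\<close>, these are at least
  \<open>M - 1 \<ge> L\<close> cells of length at least \<open>(b - a) / L\<close>, which leaves no
  room for the parts in the two end cells.\<close>

lemma overlap_window:
  fixes q :: "nat \<Rightarrow> real"
  assumes pos: "0 < overlap a b (\<Sum>i<s. q i) (\<Sum>i<Suc s. q i)"
      "0 < overlap a b (\<Sum>i<s'. q i) (\<Sum>i<Suc s'. q i)"
    and L: "\<And>i. i < s' \<Longrightarrow> b - a \<le> L * q i" "0 < L" "L + 1 \<le> real M"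
  shows "s' < s + M"
proof (rule ccontr)
  assume "\<not> ?thesis"
  then have le: "s + M \<le> s'" by simp
  then have "Suc s \<le> s'" using L(2,3) by linarith
  \<comment> \<open>Positive overlap means that \<open>a\<close> lies before the end of cell
    \<open>s\<close> and \<open>b\<close> after the start of cell \<open>s'\<close>.\<close>
  have "(\<Sum>i<s'. q i) - (\<Sum>i<Suc s. q i) < b - a"
    using pos unfolding overlap_def by (auto simp: max_def min_def split: if_splits)
  moreover have "(\<Sum>i<s'. q i) = (\<Sum>i<Suc s. q i) + (\<Sum>i=Suc s..<s'. q i)"
    unfolding lessThan_atLeast0 using \<open>Suc s \<le> s'\<close> by (intro sum.atLeastLessThan_concat[symmetric]) auto
  ultimately have "L * (\<Sum>i=Suc s..<s'. q i) < L * (b - a)" using L(2) by simp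
  also have "\<dots> \<le> real (s' - Suc s) * (b - a)"
  proof (rule mult_right_mono)
    show "L \<le> real (s' - Suc s)" using le L(3) \<open>Suc s \<le> s'\<close> by (simp add: of_nat_diff)
    show "0 \<le> b - a" using pos unfolding overlap_def by (auto simp: max_def min_def split: if_splits)
  qed
  also have "\<dots> = (\<Sum>i=Suc s..<s'. b - a)" by simp
  also have "\<dots> \<le> (\<Sum>i=Suc s..<s'. L * q i)" using L(1) by (intro sum_mono) auto
  finally show False by (simp add: sum_distrib_left)
qed

text \<open>\<open>F\<close> and \<open>G\<close> are cumulative weights and \<open>c\<close> is the
  overlap of the cells they cut out of the unit interval. The last two conclusions say that the
  support of each row and of each column lies within \<open>M\<close> consecutive positions.\<close>

lemma staircase_coupling:
  fixes p q :: "nat \<Rightarrow> real"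
  assumes p: "\<And>r. r < X \<Longrightarrow> 0 < p r" "(\<Sum>r<X. p r) = 1"
    and q: "\<And>s. s < Y \<Longrightarrow> 0 < q s" "(\<Sum>s<Y. q s) = 1"
    and L: "\<And>r s. r < X \<Longrightarrow> s < Y \<Longrightarrow> p r \<le> L * q s" "\<And>r s. r < X \<Longrightarrow> s < Y \<Longrightarrow> q s \<le> L * p r"
      "0 < L" "L + 1 \<le> real M"
  shows "\<exists>c. (\<forall>r s. 0 \<le> c r s) \<and>
    (\<forall>r<X. (\<Sum>s<Y. c r s) = p r) \<and> (\<forall>s<Y. (\<Sum>r<X. c r s) = q s) \<and>
    (\<forall>r<X. \<forall>s<Y. \<forall>s'<Y. c r s \<noteq> 0 \<longrightarrow> c r s' \<noteq> 0 \<longrightarrow> s' < s + M) \<and>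
    (\<forall>r<X. \<forall>r'<X. \<forall>s<Y. c r s \<noteq> 0 \<longrightarrow> c r' s \<noteq> 0 \<longrightarrow> r' < r + M)"
proof -
  define F G where "F r = (\<Sum>i<r. p i)" and "G s = (\<Sum>i<s. q i)" for r s
  define c where "c r s = overlap (F r) (F (Suc r)) (G s) (G (Suc s))" for r s
  have F: "F r \<le> F (Suc r)" "0 \<le> F r" "F (Suc r) \<le> 1" "F (Suc r) - F r = p r" if "r < X" for r
  proof -
    show "F r \<le> F (Suc r)" "F (Suc r) - F r = p r" using p(1)[OF that] unfolding F_def by auto
    show "0 \<le> F r" using p(1) that unfolding F_def by (intro sum_nonneg less_imp_le) auto
    show "F (Suc r) \<le> 1" unfolding F_def p(2)[symmetric] using p(1) that
      by (intro sum_mono2) (auto intro: less_imp_le)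
  qed
  have G: "G r \<le> G (Suc r)" "0 \<le> G r" "G (Suc r) \<le> 1" "G (Suc r) - G r = q r" if "r < Y" for r
  proof -
    show "G r \<le> G (Suc r)" "G (Suc r) - G r = q r" using q(1)[OF that] unfolding G_def by auto
    show "0 \<le> G r" using q(1) that unfolding G_def by (intro sum_nonneg less_imp_le) auto
    show "G (Suc r) \<le> 1" unfolding G_def q(2)[symmetric] using q(1) that
      by (intro sum_mono2) (auto intro: less_imp_le)
  qed
  have c0: "0 \<le> c r s" for r s unfolding c_def overlap_def by simp
  have row: "(\<Sum>s<Y. c r s) = p r" if "r < X" for r
    unfolding c_def using F[OF that] G(1) q(2) by (subst sum_overlap) (auto simp: G_def)
  have col: "(\<Sum>r<X. c r s) = q s" if "s < Y" for s
    unfolding c_def using G[OF that] F(1) p(2) by (subst overlap_commute, subst sum_overlap) (auto simp: F_def)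
  have w1: "s' < s + M" if "r < X" "s < Y" "s' < Y" "c r s \<noteq> 0" "c r s' \<noteq> 0" for r s s'
  proof (rule overlap_window)
    show "0 < overlap (F r) (F (Suc r)) (\<Sum>i<s. q i) (\<Sum>i<Suc s. q i)"
      "0 < overlap (F r) (F (Suc r)) (\<Sum>i<s'. q i) (\<Sum>i<Suc s'. q i)"
      using that(4,5) c0[of r s] c0[of r s'] unfolding c_def G_def by auto
    show "F (Suc r) - F r \<le> L * q i" if "i < s'" for i
      using F(4)[OF \<open>r < X\<close>] L(1)[OF \<open>r < X\<close>, of i] that \<open>s' < Y\<close> by simp
  qed (use L(3,4) in auto)
  have w2: "r' < r + M" if "r < X" "r' < X" "s < Y" "c r s \<noteq> 0" "c r' s \<noteq> 0" for r r' s
  proof (rule overlap_window)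
    show "0 < overlap (G s) (G (Suc s)) (\<Sum>i<r. p i) (\<Sum>i<Suc r. p i)"
      "0 < overlap (G s) (G (Suc s)) (\<Sum>i<r'. p i) (\<Sum>i<Suc r'. p i)"
      using that(4,5) c0[of r s] c0[of r' s] overlap_commute unfolding c_def F_def
      by (metis order_less_le)+
    show "G (Suc s) - G s \<le> L * p i" if "i < r'" for i
      using G(4)[OF \<open>s < Y\<close>] L(2)[OF _ \<open>s < Y\<close>, of i] that \<open>r' < X\<close> by simp
  qed (use L(3,4) in auto)
  show ?thesis using c0 row col w1 w2 by (intro exI[of _ c]) blast
qed

section \<open>One-shot error bounds\<close>

text \<open>Makes the garbage label \<open>(r + s) mod M\<close> injective inside a window of the
  staircase: congruent numbers differ by a multiple of \<open>M\<close>.\<close>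

lemma mod_eq_window:
  fixes a b M :: nat
  assumes "a mod M = b mod M" "a < b + M" "b < a + M"
  shows "a = b"
proof (rule ccontr)
  assume "a \<noteq> b"
  then show False
  proof (cases a b rule: linorder_cases)
    case less
    then have "M dvd b - a" using assms(1) by (metis mod_eq_dvd_iff_nat less_imp_le)
    then show False using less assms(3) by (auto dest: dvd_imp_le)
  next
    case greater
    then have "M dvd a - b" using assms(1) by (metis mod_eq_dvd_iff_nat less_imp_le)
    then show False using greater assms(2) by (auto dest: dvd_imp_le)
  qed simp
qed

text \<open>Amplitude, in the image of the \<open>r\<close>-th input eigenvector, of the
  \<open>s\<close>-th output eigenvector paired with garbage basis state \<open>l\<close>.\<close>

definition stair_coeff :: "nat \<Rightarrow> (nat \<Rightarrow> nat \<Rightarrow> real) \<Rightarrow> (nat \<Rightarrow> real) \<Rightarrow> nat \<Rightarrow> nat \<Rightarrow> nat \<Rightarrow> real" where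
  "stair_coeff M c p r s l = (if (r + s) mod M = l then sqrt (c r s / p r) else 0)"

definition stair_vec :: "nat \<Rightarrow> nat \<Rightarrow> (nat \<Rightarrow> nat \<Rightarrow> real) \<Rightarrow> (nat \<Rightarrow> real) \<Rightarrow> (nat \<Rightarrow> nat \<Rightarrow> complex) \<Rightarrow>
    nat \<Rightarrow> nat \<Rightarrow> complex" where
  "stair_vec M Y c p f r i = (\<Sum>s<Y. of_real (stair_coeff M c p r s (i mod M)) * f s (i div M))"

lemma stair_vec_block:
  "l < M \<Longrightarrow> stair_vec M Y c p f r (i * M + l) = (\<Sum>s<Y. of_real (stair_coeff M c p r s l) * f s i)"
  unfolding stair_vec_def by simp

lemma sum_stair_coeff:
  assumes "0 < M"
  shows "(\<Sum>l<M. stair_coeff M c p r s l * stair_coeff M c p r' s' l)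
    = (if (r + s) mod M = (r' + s') mod M then sqrt (c r s / p r) * sqrt (c r' s' / p r') else 0)"
proof -
  have "(\<Sum>l<M. stair_coeff M c p r s l * stair_coeff M c p r' s' l)
    = (\<Sum>l<M. if (r + s) mod M = l then (if (r + s) mod M = (r' + s') mod M then sqrt (c r s / p r) * sqrt (c r' s' / p r') else 0) else 0)"
    unfolding stair_coeff_def by (intro sum.cong) auto
  then show ?thesis using assms by simp
qed

section \<open>Staircase vectors: orthonormality and reduced states\<close>

context
  fixes c :: "nat \<Rightarrow> nat \<Rightarrow> real" and p :: "nat \<Rightarrow> real" and X Y M :: nat
  assumes M: "0 < M" and c0: "\<And>r s. 0 \<le> c r s" and p0: "\<And>r. r < X \<Longrightarrow> 0 < p r"
    and row_window: "\<And>r s s'. r < X \<Longrightarrow> s < Y \<Longrightarrow> s' < Y \<Longrightarrow> c r s \<noteq> 0 \<Longrightarrow> c r s' \<noteq> 0 \<Longrightarrow> s' < s + M"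
    and column_window: "\<And>r r' s. r < X \<Longrightarrow> r' < X \<Longrightarrow> s < Y \<Longrightarrow> c r s \<noteq> 0 \<Longrightarrow> c r' s \<noteq> 0 \<Longrightarrow> r' < r + M"
begin

text \<open>Two different \<open>s\<close> in the support of one row are less than \<open>M\<close>
  apart, so their garbage labels differ and the cross term vanishes.\<close>

lemma sum_stair_coeff_row:
  assumes "r < X" "s < Y" "s' < Y"
  shows "(\<Sum>l<M. stair_coeff M c p r s l * stair_coeff M c p r s' l) = (if s = s' then c r s / p r else 0)"
proof (cases "s = s'")
  case True
  then show ?thesis unfolding sum_stair_coeff[OF M] using c0[of r s] p0[OF assms(1)] by simp
next
  case False
  have "c r s = 0 \<or> c r s' = 0" if "(r + s) mod M = (r + s') mod M"
    using mod_eq_window[OF that] row_window[OF assms] row_window[OF assms(1,3,2)] False by force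
  then show ?thesis unfolding sum_stair_coeff[OF M] using False by auto
qed

lemma sum_stair_coeff_column:
  assumes "r < X" "r' < X" "s < Y"
  shows "(\<Sum>l<M. stair_coeff M c p r s l * stair_coeff M c p r' s l) = (if r = r' then c r s / p r else 0)"
proof (cases "r = r'")
  case True
  then show ?thesis unfolding sum_stair_coeff[OF M] using c0[of r s] p0[OF assms(1)] by simp
next
  case False
  have "c r s = 0 \<or> c r' s = 0" if "(r + s) mod M = (r' + s) mod M"
    using mod_eq_window[OF that] column_window[OF assms] column_window[OF assms(2,1,3)] False by force
  then show ?thesis unfolding sum_stair_coeff[OF M] using False by auto
qed

text \<open>Orthonormality of \<open>f\<close> leaves only terms with a common \<open>s\<close>. For
  \<open>r \<noteq> r'\<close> the column window separates their garbage labels; for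
  \<open>r = r'\<close> the row sum gives norm 1.\<close>

lemma stair_vec_orthonormal:
  assumes f: "orthonormal A {..<Y} f" and row: "\<And>r. r < X \<Longrightarrow> (\<Sum>s<Y. c r s) = p r"
  shows "orthonormal (A * M) {..<X} (stair_vec M Y c p f)"
  unfolding orthonormal_def
proof (intro ballI)
  fix r r' assume "r \<in> {..<X}" "r' \<in> {..<X}"
  then have r: "r < X" "r' < X" by auto
  let ?\<beta> = "stair_coeff M c p"
  have "iprod (A * M) (stair_vec M Y c p f r) (stair_vec M Y c p f r')
      = (\<Sum>l<M. iprod A (\<lambda>i. \<Sum>s<Y. of_real (?\<beta> r s l) * f s i) (\<lambda>i. \<Sum>s<Y. of_real (?\<beta> r' s l) * f s i))"
    unfolding iprod_blocks by (intro sum.cong refl) (simp add: stair_vec_block)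
  also have "\<dots> = (\<Sum>l<M. \<Sum>s<Y. of_real (?\<beta> r s l * ?\<beta> r' s l))"
  proof (intro sum.cong refl)
    fix l
    have "iprod A (\<lambda>i. \<Sum>s<Y. of_real (?\<beta> r s l) * f s i) (\<lambda>i. \<Sum>s<Y. of_real (?\<beta> r' s l) * f s i)
      = (\<Sum>s<Y. of_real (?\<beta> r s l) * (\<Sum>s'<Y. if s = s' then of_real (?\<beta> r' s' l) else 0))"
      unfolding iprod_sum_left iprod_sum_right
      by (intro sum.cong arg_cong2[where f = "(*)"] refl) (auto simp: orthonormalD[OF f])
    also have "\<dots> = (\<Sum>s<Y. of_real (?\<beta> r s l * ?\<beta> r' s l))" by (intro sum.cong) auto
    finally show "iprod A (\<lambda>i. \<Sum>s<Y. of_real (?\<beta> r s l) * f s i) (\<lambda>i. \<Sum>s<Y. of_real (?\<beta> r' s l) * f s i)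
      = (\<Sum>s<Y. of_real (?\<beta> r s l * ?\<beta> r' s l))" .
  qed
  also have "\<dots> = of_real (\<Sum>s<Y. \<Sum>l<M. ?\<beta> r s l * ?\<beta> r' s l)"
    by (subst sum.swap) simp
  also have "(\<Sum>s<Y. \<Sum>l<M. ?\<beta> r s l * ?\<beta> r' s l) = (\<Sum>s<Y. if r = r' then c r s / p r else 0)"
    using sum_stair_coeff_column[OF r] by (intro sum.cong) auto
  also have "\<dots> = (if r = r' then 1 else 0)"
    using row[OF r(1)] p0[OF r(1)] by (cases "r = r'") (simp_all flip: sum_divide_distrib)
  finally show "iprod (A * M) (stair_vec M Y c p f r) (stair_vec M Y c p f r') = (if r = r' then 1 else 0)"
    by simp
qed

text \<open>Garbage labels are distinct within a row, so tracing them out removes all coherence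
  between different \<open>s\<close>; the reduced state is diagonal in the
  \<open>f s\<close>.\<close>

lemma stair_vec_reduced:
  assumes "r < X"
  shows "(\<Sum>l<M. stair_vec M Y c p f r (i * M + l) * cnj (stair_vec M Y c p f r (j * M + l)))
    = (\<Sum>s<Y. of_real (c r s / p r) * f s i * cnj (f s j))"
proof -
  let ?\<beta> = "stair_coeff M c p"
  have "(\<Sum>l<M. stair_vec M Y c p f r (i * M + l) * cnj (stair_vec M Y c p f r (j * M + l)))
      = (\<Sum>l<M. \<Sum>s<Y. \<Sum>s'<Y. of_real (?\<beta> r s l * ?\<beta> r s' l) * (f s i * cnj (f s' j)))"
  proof (intro sum.cong refl)
    fix l assume "l \<in> {..<M}"
    then show "stair_vec M Y c p f r (i * M + l) * cnj (stair_vec M Y c p f r (j * M + l))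
      = (\<Sum>s<Y. \<Sum>s'<Y. of_real (?\<beta> r s l * ?\<beta> r s' l) * (f s i * cnj (f s' j)))"
      by (simp add: stair_vec_block sum_product) (simp add: mult_ac)
  qed
  also have "\<dots> = (\<Sum>s<Y. \<Sum>l<M. \<Sum>s'<Y. of_real (?\<beta> r s l * ?\<beta> r s' l) * (f s i * cnj (f s' j)))"
    by (rule sum.swap)
  also have "\<dots> = (\<Sum>s<Y. \<Sum>s'<Y. \<Sum>l<M. of_real (?\<beta> r s l * ?\<beta> r s' l) * (f s i * cnj (f s' j)))"
    by (intro sum.cong refl sum.swap)
  also have "\<dots> = (\<Sum>s<Y. \<Sum>s'<Y. if s = s' then of_real (c r s / p r) * (f s i * cnj (f s' j)) else 0)"
  proof (intro sum.cong refl)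
    fix s s' assume "s \<in> {..<Y}" "s' \<in> {..<Y}"
    then have "(\<Sum>l<M. of_real (?\<beta> r s l * ?\<beta> r s' l)) = (of_real (if s = s' then c r s / p r else 0) :: complex)"
      unfolding of_real_sum[symmetric] using sum_stair_coeff_row[OF assms, of s s'] by simp
    then show "(\<Sum>l<M. of_real (?\<beta> r s l * ?\<beta> r s' l) * (f s i * cnj (f s' j)))
        = (if s = s' then of_real (c r s / p r) * (f s i * cnj (f s' j)) else 0)"
      unfolding sum_distrib_right[symmetric] by simp
  qed
  also have "\<dots> = (\<Sum>s<Y. of_real (c r s / p r) * f s i * cnj (f s j))"
    by (intro sum.cong refl) (simp add: mult.assoc)
  finally show ?thesis .
qed

end

text \<open>\<open>E\<close> lists the eigenvectors of the input with its ancillas and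
  \<open>G\<close> their images under the unitary. Both are parameters tied by equations, so that a
  construction can use its own names for them.\<close>

lemma protocol_output_outer:
  assumes \<rho>: "decomp d \<rho> u p" "0 < d" and dims: "copy_qubits \<rho> n + k = copy_qubits \<sigma> n + g"
    and \<psi>: "\<psi> \<in> carrier_vec (2 ^ k)" "\<psi> \<bullet>c \<psi> = 1"
    and U: "unitary_mat (2 ^ (copy_qubits \<rho> n + k)) U"
    and E: "E = (\<lambda>x i. pad (d ^ n) (tensor_vec u d n x) (i div 2 ^ k) * \<psi> $ (i mod 2 ^ k))"
    and G: "G = (\<lambda>x. matvec (2 ^ (copy_qubits \<rho> n + k)) (\<lambda>i j. U $$ (i, j)) (E x))"
  shows "orthonormal (2 ^ copy_qubits \<sigma> n * 2 ^ g) {..<d ^ n} G"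
    and "outer (2 ^ copy_qubits \<sigma> n) (protocol_output \<rho> \<sigma> n g \<psi> U) ({..<d ^ n} \<times> {..<2 ^ g})
      (\<lambda>(x, l). tensor_weight p d n x) (\<lambda>(x, l) i. G x (i * 2 ^ g + l))"
proof -
  let ?N = "2 ^ (copy_qubits \<rho> n + k)"
  have N: "2 ^ copy_qubits \<rho> n * 2 ^ k = (?N::nat)" "2 ^ copy_qubits \<sigma> n * 2 ^ g = (?N::nat)"
    using dims by (simp_all flip: power_add)
  note c = copies_outer[OF \<rho>, of n]
  have oE: "orthonormal ?N {..<d ^ n} E"
    and A: "outer ?N (kron (copies \<rho> n) (projector \<psi>)) {..<d ^ n} (tensor_weight p d n) E"
    using kron_projector_outer[OF c(2,1) \<psi>] unfolding N E by auto
  show "orthonormal (2 ^ copy_qubits \<sigma> n * 2 ^ g) {..<d ^ n} G"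
    using oE unitary_matvec_iprod[OF U] unfolding orthonormal_def N G by simp
  have "outer ?N (U * kron (copies \<rho> n) (projector \<psi>) * mat_adjoint U) {..<d ^ n} (tensor_weight p d n) G"
    unfolding G using conj_outer[OF A] U unfolding unitary_mat_def by blast
  then show "outer (2 ^ copy_qubits \<sigma> n) (protocol_output \<rho> \<sigma> n g \<psi> U) ({..<d ^ n} \<times> {..<2 ^ g})
      (\<lambda>(x, l). tensor_weight p d n x) (\<lambda>(x, l) i. G x (i * 2 ^ g + l))"
    unfolding protocol_output_def N(2)[symmetric] by (rule partial_trace_outer) simp
qed

text \<open>Dimension argument. The slices of the evolved vectors from \<open>T\<close> span at most
  \<open>card T * 2 ^ g\<close> dimensions. On this span the output has at least the weight of
  \<open>T\<close>, while the copies of \<open>\<sigma>\<close> have at most \<open>m\<close> per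
  dimension plus the weight outside \<open>T'\<close>.\<close>

theorem protocol_error_lower_bound:
  assumes \<rho>: "decomp d \<rho> u p" "\<And>x. x < d \<Longrightarrow> 0 \<le> p x"
    and \<sigma>: "decomp D \<sigma> v q" "\<And>x. x < D \<Longrightarrow> 0 \<le> q x" "(\<Sum>x<D. q x) = 1"
    and pos: "0 < d" "0 < D"
    and dims: "copy_qubits \<rho> n + k = copy_qubits \<sigma> n + g"
    and \<psi>: "\<psi> \<in> carrier_vec (2 ^ k)" "\<psi> \<bullet>c \<psi> = 1"
    and U: "unitary_mat (2 ^ (copy_qubits \<rho> n + k)) U"
    and T: "T \<subseteq> {..<d ^ n}" "T' \<subseteq> {..<D ^ n}"
    and m: "0 \<le> m" "\<And>y. y \<in> T' \<Longrightarrow> tensor_weight q D n y \<le> m"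
  shows "(\<Sum>x\<in>T. tensor_weight p d n x) - (1 - (\<Sum>y\<in>T'. tensor_weight q D n y)) - m * (real (card T) * 2 ^ g)
    \<le> trace_norm (protocol_output \<rho> \<sigma> n g \<psi> U - copies \<sigma> n)"
proof -
  let ?A = "2 ^ copy_qubits \<sigma> n" and ?B = "2 ^ g :: nat"
  let ?p = "tensor_weight p d n" and ?q = "tensor_weight q D n"
  obtain G where oG: "orthonormal (?A * ?B) {..<d ^ n} G"
    and out: "outer ?A (protocol_output \<rho> \<sigma> n g \<psi> U) ({..<d ^ n} \<times> {..<?B})
      (\<lambda>(x, l). ?p x) (\<lambda>(x, l) i. G x (i * ?B + l))"
    using protocol_output_outer[OF \<rho>(1) pos(1) dims \<psi> U refl refl] by blast
  define h where "h = (\<lambda>(x, l) i. G x (i * ?B + l))"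
  define e where "e y = pad (D ^ n) (tensor_vec v D n y)" for y
  have oe: "orthonormal ?A {..<D ^ n} e" and cop: "outer ?A (copies \<sigma> n) {..<D ^ n} ?q e"
    using copies_outer[OF \<sigma>(1) pos(2), of n] unfolding e_def by auto
  have fT: "finite T" "finite T'" using T finite_subset by auto
  have p0: "0 \<le> ?p x" if "x < d ^ n" for x by (rule tensor_weight_nonneg[OF \<rho>(2) that])
  have q0: "0 \<le> ?q y" if "y < D ^ n" for y by (rule tensor_weight_nonneg[OF \<sigma>(2) that])
  obtain r w where r: "r \<le> card (T \<times> {..<?B})" and ow: "orthonormal ?A {..<r} w"
    and cap: "\<And>z. z \<in> T \<times> {..<?B} \<Longrightarrow> (\<Sum>i<r. (cmod (iprod ?A (h z) (w i)))\<^sup>2) = norm_sq ?A (h z)"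
    using orthonormal_capture[of "T \<times> {..<?B}" ?A h] fT by auto
  have sym: "cmod (iprod N a b) = cmod (iprod N b a)" for N a b
    by (subst iprod_cnj[symmetric]) simp
  let ?Z = "{..<d ^ n} \<times> {..<?B}"
  \<comment> \<open>\<open>trace_norm_ge\<close> for the difference of the two states, compressed to
    the span of the \<open>w i\<close>.\<close>
  have "(\<Sum>i<r. (\<Sum>z\<in>?Z. (case z of (x, l) \<Rightarrow> ?p x) * (cmod (iprod ?A (w i) (h z)))\<^sup>2)
        - (\<Sum>y<D ^ n. ?q y * (cmod (iprod ?A (w i) (e y)))\<^sup>2))
      \<le> trace_norm (protocol_output \<rho> \<sigma> n g \<psi> U - copies \<sigma> n)"
    using trace_norm_ge[OF outer_minus[OF out cop] ow] by (simp add: sum.Plus sum_negf h_def)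
  moreover have "(\<Sum>x\<in>T. ?p x) \<le> (\<Sum>i<r. \<Sum>z\<in>?Z. (case z of (x, l) \<Rightarrow> ?p x) * (cmod (iprod ?A (w i) (h z)))\<^sup>2)"
  proof -
    have "(\<Sum>x\<in>T. ?p x) = (\<Sum>x\<in>T. ?p x * norm_sq (?A * ?B) (G x))"
      using orthonormal_norm_sq[OF oG] T by (intro sum.cong) auto
    also have "\<dots> = (\<Sum>z\<in>T \<times> {..<?B}. (case z of (x, l) \<Rightarrow> ?p x) * norm_sq ?A (h z))"
      unfolding norm_sq_blocks by (simp add: sum_distrib_left sum.cartesian_product h_def split_def)
    also have "\<dots> = (\<Sum>z\<in>T \<times> {..<?B}. (case z of (x, l) \<Rightarrow> ?p x) * (\<Sum>i<r. (cmod (iprod ?A (w i) (h z)))\<^sup>2))"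
      using cap sym by (intro sum.cong) auto
    also have "\<dots> \<le> (\<Sum>z\<in>?Z. (case z of (x, l) \<Rightarrow> ?p x) * (\<Sum>i<r. (cmod (iprod ?A (w i) (h z)))\<^sup>2))"
      using T p0 by (intro sum_mono2) (auto intro!: mult_nonneg_nonneg sum_nonneg)
    also have "\<dots> = (\<Sum>i<r. \<Sum>z\<in>?Z. (case z of (x, l) \<Rightarrow> ?p x) * (cmod (iprod ?A (w i) (h z)))\<^sup>2)"
      by (subst sum.swap) (simp add: sum_distrib_left)
    finally show ?thesis .
  qed
  moreover have "(\<Sum>i<r. \<Sum>y<D ^ n. ?q y * (cmod (iprod ?A (w i) (e y)))\<^sup>2)
      \<le> m * (real (card T) * 2 ^ g) + (1 - (\<Sum>y\<in>T'. ?q y))"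
  proof -
    \<comment> \<open>\<open>\<kappa> y\<close> is the squared length of the projection of
      \<open>e y\<close> to the span of the \<open>w i\<close>: at most 1 for each \<open>y\<close>,
      and in total at most the dimension \<open>r\<close>.\<close>
    define \<kappa> where "\<kappa> y = (\<Sum>i<r. (cmod (iprod ?A (w i) (e y)))\<^sup>2)" for y
    have \<kappa>0: "0 \<le> \<kappa> y" for y unfolding \<kappa>_def by (simp add: sum_nonneg)
    have \<kappa>1: "\<kappa> y \<le> 1" if "y < D ^ n" for y
      using bessel'[OF ow, of "e y"] orthonormal_norm_sq[OF oe] that unfolding \<kappa>_def by simp
    have "(\<Sum>y<D ^ n. \<kappa> y) = (\<Sum>i<r. \<Sum>y<D ^ n. (cmod (iprod ?A (w i) (e y)))\<^sup>2)"
      unfolding \<kappa>_def by (rule sum.swap)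
    also have "\<dots> \<le> (\<Sum>i<r. 1)"
    proof (rule sum_mono)
      fix i assume "i \<in> {..<r}"
      then show "(\<Sum>y<D ^ n. (cmod (iprod ?A (w i) (e y)))\<^sup>2) \<le> 1"
        using bessel[OF oe, of "w i"] orthonormal_norm_sq[OF ow] by simp
    qed
    also have "\<dots> \<le> real (card T) * 2 ^ g"
      using r by (simp add: card_cartesian_product flip: of_nat_le_iff[where 'a = real])
    finally have \<kappa>s: "(\<Sum>y<D ^ n. \<kappa> y) \<le> real (card T) * 2 ^ g" .
    have "(\<Sum>i<r. \<Sum>y<D ^ n. ?q y * (cmod (iprod ?A (w i) (e y)))\<^sup>2) = (\<Sum>y<D ^ n. ?q y * \<kappa> y)"
      unfolding \<kappa>_def by (subst sum.swap) (simp add: sum_distrib_left)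
    also have "\<dots> = (\<Sum>y\<in>{..<D ^ n} - T'. ?q y * \<kappa> y) + (\<Sum>y\<in>T'. ?q y * \<kappa> y)"
      using T(2) by (intro sum.subset_diff) auto
    also have "(\<Sum>y\<in>T'. ?q y * \<kappa> y) \<le> (\<Sum>y\<in>T'. m * \<kappa> y)"
      using m(2) \<kappa>0 by (intro sum_mono mult_right_mono) auto
    also have "\<dots> \<le> m * (\<Sum>y<D ^ n. \<kappa> y)"
      unfolding sum_distrib_left[symmetric] using T(2) \<kappa>0 m(1) by (intro mult_left_mono sum_mono2) auto
    also have "\<dots> \<le> m * (real (card T) * 2 ^ g)" using \<kappa>s m(1) by (intro mult_left_mono)
    also have "(\<Sum>y\<in>{..<D ^ n} - T'. ?q y * \<kappa> y) \<le> (\<Sum>y\<in>{..<D ^ n} - T'. ?q y)"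
      using q0 \<kappa>1 by (intro sum_mono mult_left_le) auto
    also have "\<dots> = 1 - (\<Sum>y\<in>T'. ?q y)"
      using sum.subset_diff[OF T(2), of ?q] sum_tensor_weight[OF \<sigma>(3), of n] by simp
    finally show ?thesis by simp
  qed
  ultimately show ?thesis by (simp add: sum_subtractf)
qed

text \<open>The weights on \<open>T\<close> and \<open>T'\<close> are renormalised and coupled by
  the staircase, and the unitary sends the inputs from \<open>T\<close> to the staircase vectors.
  Error comes only from inputs outside \<open>T\<close>, target weight outside \<open>T'\<close>,
  and the mismatch of \<open>P\<close> and \<open>Q\<close>.\<close>

theorem protocol_exists:
  assumes \<rho>: "decomp d \<rho> u p" "\<And>x. x < d \<Longrightarrow> 0 \<le> p x" "(\<Sum>x<d. p x) = 1"
    and \<sigma>: "decomp D \<sigma> v q" "\<And>x. x < D \<Longrightarrow> 0 \<le> q x" "(\<Sum>x<D. q x) = 1"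
    and pos: "0 < d" "0 < D"
    and dims: "copy_qubits \<rho> n + k = copy_qubits \<sigma> n + g"
    and T: "T \<subseteq> {..<d ^ n}" "T' \<subseteq> {..<D ^ n}"
    and Tpos: "\<And>x. x \<in> T \<Longrightarrow> 0 < tensor_weight p d n x" "\<And>y. y \<in> T' \<Longrightarrow> 0 < tensor_weight q D n y"
    and P: "P = (\<Sum>x\<in>T. tensor_weight p d n x)" "0 < P"
    and Q: "Q = (\<Sum>y\<in>T'. tensor_weight q D n y)" "0 < Q"
    and L: "\<And>x y. x \<in> T \<Longrightarrow> y \<in> T' \<Longrightarrow> tensor_weight p d n x / P \<le> L * (tensor_weight q D n y / Q)"
      "\<And>x y. x \<in> T \<Longrightarrow> y \<in> T' \<Longrightarrow> tensor_weight q D n y / Q \<le> L * (tensor_weight p d n x / P)"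
      "0 < L" "L + 1 \<le> 2 ^ g"
  shows "\<exists>\<psi> U. \<psi> \<in> carrier_vec (2 ^ k) \<and> \<psi> \<bullet>c \<psi> = 1 \<and> unitary_mat (2 ^ (copy_qubits \<rho> n + k)) U \<and>
    0 \<le> trace_norm (protocol_output \<rho> \<sigma> n g \<psi> U - copies \<sigma> n) \<and>
    trace_norm (protocol_output \<rho> \<sigma> n g \<psi> U - copies \<sigma> n) \<le> 2 * ((1 - P) + (1 - Q))"
proof -
  let ?A = "2 ^ copy_qubits \<sigma> n :: nat" and ?B = "2 ^ g :: nat" and ?N = "2 ^ (copy_qubits \<rho> n + k) :: nat"
  let ?p = "tensor_weight p d n" and ?q = "tensor_weight q D n"
  have N: "2 ^ copy_qubits \<rho> n * 2 ^ k = (?N::nat)" "?A * ?B = (?N::nat)"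
    using dims by (simp_all flip: power_add)
  have fin: "finite T" "finite T'" using T finite_subset by auto
  have p0: "0 \<le> ?p x" if "x < d ^ n" for x by (rule tensor_weight_nonneg[OF \<rho>(2) that])
  have q0: "0 \<le> ?q y" if "y < D ^ n" for y by (rule tensor_weight_nonneg[OF \<sigma>(2) that])
  obtain X t where t: "bij_betw t {..<X::nat} T"
    using ex_bij_betw_nat_finite[OF fin(1)] unfolding lessThan_atLeast0 by auto
  obtain Y s where s: "bij_betw s {..<Y::nat} T'"
    using ex_bij_betw_nat_finite[OF fin(2)] unfolding lessThan_atLeast0 by auto
  have tT: "t r \<in> T" if "r < X" for r using t that unfolding bij_betw_def by auto
  have sT: "s r \<in> T'" if "r < Y" for r using s that unfolding bij_betw_def by auto
  define p' q' where "p' r = ?p (t r) / P" and "q' r = ?q (s r) / Q" for r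
  have p'0: "0 < p' r" if "r < X" for r using Tpos(1)[OF tT[OF that]] P(2) unfolding p'_def by simp
  have q'0: "0 < q' r" if "r < Y" for r using Tpos(2)[OF sT[OF that]] Q(2) unfolding q'_def by simp
  have p'1: "(\<Sum>r<X. p' r) = 1" unfolding p'_def sum_divide_distrib[symmetric]
    using sum.reindex_bij_betw[OF t, of ?p] P by simp
  have q'1: "(\<Sum>r<Y. q' r) = 1" unfolding q'_def sum_divide_distrib[symmetric]
    using sum.reindex_bij_betw[OF s, of ?q] Q by simp
  have L1: "p' r \<le> L * q' j" if "r < X" "j < Y" for r j
    using L(1)[OF tT[OF that(1)] sT[OF that(2)]] unfolding p'_def q'_def .
  have L2: "q' j \<le> L * p' r" if "r < X" "j < Y" for r j
    using L(2)[OF tT[OF that(1)] sT[OF that(2)]] unfolding p'_def q'_def .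
  have L4: "L + 1 \<le> real ?B" using L(4) by simp
  have "\<exists>c. (\<forall>r j. 0 \<le> c r j) \<and>
    (\<forall>r<X. (\<Sum>j<Y. c r j) = p' r) \<and> (\<forall>j<Y. (\<Sum>r<X. c r j) = q' j) \<and>
    (\<forall>r<X. \<forall>j<Y. \<forall>j'<Y. c r j \<noteq> 0 \<longrightarrow> c r j' \<noteq> 0 \<longrightarrow> j' < j + ?B) \<and>
    (\<forall>r<X. \<forall>r'<X. \<forall>j<Y. c r j \<noteq> 0 \<longrightarrow> c r' j \<noteq> 0 \<longrightarrow> r' < r + ?B)"
    by (rule staircase_coupling[where L = L]) (fact p'0 p'1 q'0 q'1 L1 L2 L(3) L4)+
  then obtain c where staircase: "\<forall>r j. 0 \<le> c r j" "\<forall>r<X. (\<Sum>j<Y. c r j) = p' r"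
    "\<forall>j<Y. (\<Sum>r<X. c r j) = q' j"
    "\<forall>r<X. \<forall>j<Y. \<forall>j'<Y. c r j \<noteq> 0 \<longrightarrow> c r j' \<noteq> 0 \<longrightarrow> j' < j + ?B"
    "\<forall>r<X. \<forall>r'<X. \<forall>j<Y. c r j \<noteq> 0 \<longrightarrow> c r' j \<noteq> 0 \<longrightarrow> r' < r + ?B"
    by (elim exE conjE)
  note c = staircase[rule_format]
  define e where "e y = pad (D ^ n) (tensor_vec v D n y)" for y
  have oe: "orthonormal ?A {..<D ^ n} e" and cop: "outer ?A (copies \<sigma> n) {..<D ^ n} ?q e"
    using copies_outer[OF \<sigma>(1) pos(2), of n] unfolding e_def by auto
  define f where "f j = e (s j)" for j
  have onf: "orthonormal ?A {..<Y} f"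
    unfolding orthonormal_def f_def
  proof (intro ballI)
    fix x y assume xy: "x \<in> {..<Y}" "y \<in> {..<Y}"
    then have "s x = s y \<longleftrightarrow> x = y" using s unfolding bij_betw_def inj_on_def by blast
    then show "iprod ?A (e (s x)) (e (s y)) = (if x = y then 1 else 0)"
      using orthonormalD[OF oe, of "s x" "s y"] sT[of x] sT[of y] T(2) xy by (auto simp: subset_iff)
  qed
  define F where "F = stair_vec ?B Y c p' f"
  have oF: "orthonormal ?N {..<X} F"
    unfolding N(2)[symmetric] F_def
    by (rule stair_vec_orthonormal[OF _ c(1) p'0 c(4,5) onf c(2)]) simp_all
  define \<psi> :: "complex vec" where "\<psi> = unit_vec (2 ^ k) 0"
  have \<psi>: "\<psi> \<in> carrier_vec (2 ^ k)" "\<psi> \<bullet>c \<psi> = 1"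
  proof -
    show "\<psi> \<in> carrier_vec (2 ^ k)" unfolding \<psi>_def by simp
    have "conjugate \<psi> = \<psi>" unfolding \<psi>_def by (intro eq_vecI) (auto simp: unit_vec_def)
    then show "\<psi> \<bullet>c \<psi> = 1" unfolding \<psi>_def by simp
  qed
  define E where "E = (\<lambda>x i. pad (d ^ n) (tensor_vec u d n x) (i div 2 ^ k) * \<psi> $ (i mod 2 ^ k))"
  note cr = copies_outer[OF \<rho>(1) pos(1), of n]
  have oE: "orthonormal ?N {..<d ^ n} E"
    using kron_projector_outer(1)[OF cr(2,1) \<psi>] unfolding N E_def .
  define ti where "ti = inv_into {..<X} t"
  have ti: "ti x < X" "t (ti x) = x" if "x \<in> T" for x
    using that t unfolding ti_def bij_betw_def by (auto simp: f_inv_into_f inv_into_into)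
  have ti': "ti (t r) = r" if "r < X" for r
    using that t unfolding ti_def bij_betw_def by simp
  \<comment> \<open>\<open>ti\<close> recovers the row number of an input, which turns the staircase
    vectors into a family on \<open>T\<close>, the prescribed images of the
    \<open>E x\<close>.\<close>
  have "orthonormal ?N T (\<lambda>x. F (ti x))"
    unfolding orthonormal_def
  proof (intro ballI)
    fix x y assume xy: "x \<in> T" "y \<in> T"
    then have "ti x = ti y \<longleftrightarrow> x = y" using ti by metis
    then show "iprod ?N (F (ti x)) (F (ti y)) = (if x = y then 1 else 0)"
      using orthonormalD[OF oF] ti xy by auto
  qed
  moreover have "orthonormal ?N T E" using oE T(1) unfolding orthonormal_def by blast
  ultimately obtain U where U: "unitary_mat ?N U"
    "\<And>x i. x \<in> T \<Longrightarrow> i < ?N \<Longrightarrow> matvec ?N (\<lambda>i j. U $$ (i, j)) (E x) i = F (ti x) i"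
    using exists_unitary_mapping[of ?N T E "\<lambda>x. F (ti x)"] fin(1) by blast
  define G where "G = (\<lambda>x. matvec ?N (\<lambda>i j. U $$ (i, j)) (E x))"
  have oG: "orthonormal (?A * ?B) {..<d ^ n} G"
    and out: "outer ?A (protocol_output \<rho> \<sigma> n g \<psi> U) ({..<d ^ n} \<times> {..<?B})
      (\<lambda>(x, l). ?p x) (\<lambda>(x, l) i. G x (i * ?B + l))"
    using protocol_output_outer[OF \<rho>(1) pos(1) dims \<psi> U(1) E_def G_def] by auto
  define \<Delta> where "\<Delta> = protocol_output \<rho> \<sigma> n g \<psi> U - copies \<sigma> n"
  \<comment> \<open>The output has weight \<open>P / Q * ?q y\<close> on \<open>e y\<close> for
    \<open>y\<close> in \<open>T'\<close>: the inputs from \<open>T\<close> have total weight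
    \<open>P\<close>, and the coupling distributes it in proportion to
    \<open>?q y / Q\<close>.\<close>
  define w where "w y = (if y \<in> T' then P / Q * ?q y else 0) - ?q y" for y
  let ?R = "{..<d ^ n} - T"
  \<comment> \<open>The contribution of \<open>T\<close> is diagonal in \<open>e\<close> and is
    merged with the target before norms are taken, so that the two nearly cancel; only the other
    inputs keep their slices.\<close>
  have \<Delta>_outer: "outer ?A \<Delta> ({..<D ^ n} <+> ?R \<times> {..<?B}) (case_sum w (\<lambda>(x, l). ?p x))
      (case_sum e (\<lambda>(x, l) i. G x (i * ?B + l)))"
    unfolding outer_def
  proof (intro conjI allI impI)
    show "\<Delta> \<in> carrier_mat ?A ?A" using outerD(1)[OF out] outerD(1)[OF cop] unfolding \<Delta>_def by (metis minus_carrier_mat)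
    fix i j assume ij: "i < ?A" "j < ?A"
    define B where "B x = (\<Sum>l<?B. G x (i * ?B + l) * cnj (G x (j * ?B + l)))" for x
    have blk: "i * ?B + l < ?N" if "i < ?A" "l < ?B" for i l
    proof -
      have "i * ?B + l < Suc i * ?B" using that by simp
      also have "\<dots> \<le> ?A * ?B" using that by (intro mult_right_mono) auto
      finally show ?thesis unfolding N .
    qed
    have Bt: "B (t r) = (\<Sum>j'<Y. of_real (c r j' / p' r) * f j' i * cnj (f j' j))" if "r < X" for r
    proof -
      have "B (t r) = (\<Sum>l<?B. F r (i * ?B + l) * cnj (F r (j * ?B + l)))"
        unfolding B_def using U(2)[OF tT[OF that]] blk ij ti'[OF that]
        by (intro sum.cong refl) (simp add: G_def)
      also have "\<dots> = (\<Sum>j'<Y. of_real (c r j' / p' r) * f j' i * cnj (f j' j))"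
        unfolding F_def by (rule stair_vec_reduced[OF _ c(1) p'0 c(4,5) that]) simp_all
      finally show ?thesis .
    qed
    have "(\<Sum>x\<in>T. of_real (?p x) * B x) = (\<Sum>r<X. of_real (?p (t r)) * B (t r))"
      by (rule sum.reindex_bij_betw[OF t, symmetric])
    also have "\<dots> = (\<Sum>r<X. \<Sum>j'<Y. of_real (P * c r j') * (f j' i * cnj (f j' j)))"
    proof (intro sum.cong refl)
      fix r assume "r \<in> {..<X}"
      then have r: "r < X" by simp
      have "?p (t r) = P * p' r" using P(2) unfolding p'_def by simp
      then have "?p (t r) * (c r j' / p' r) = P * c r j'" for j' using p'0[OF r] by simp
      then have "of_real (?p (t r)) * (of_real (c r j' / p' r) * f j' i * cnj (f j' j))
          = of_real (P * c r j') * (f j' i * cnj (f j' j))" for j'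
        by (simp only: mult.assoc[symmetric] of_real_mult[symmetric])
      then show "of_real (?p (t r)) * B (t r) = (\<Sum>j'<Y. of_real (P * c r j') * (f j' i * cnj (f j' j)))"
        unfolding Bt[OF r] sum_distrib_left by simp
    qed
    also have "\<dots> = (\<Sum>j'<Y. \<Sum>r<X. of_real (P * c r j') * (f j' i * cnj (f j' j)))"
      by (rule sum.swap)
    \<comment> \<open>The column sums of the coupling.\<close>
    also have "\<dots> = (\<Sum>j'<Y. of_real (P / Q * ?q (s j')) * (e (s j') i * cnj (e (s j') j)))"
    proof (intro sum.cong refl)
      fix j' assume "j' \<in> {..<Y}"
      then have "(\<Sum>r<X. P * c r j') = P / Q * ?q (s j')"
        using c(3)[of j'] unfolding sum_distrib_left[symmetric] q'_def by simp
      then have "(\<Sum>r<X. of_real (P * c r j')) = (of_real (P / Q * ?q (s j')) :: complex)"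
        unfolding of_real_sum[symmetric] by simp
      then show "(\<Sum>r<X. of_real (P * c r j') * (f j' i * cnj (f j' j)))
          = of_real (P / Q * ?q (s j')) * (e (s j') i * cnj (e (s j') j))"
        unfolding sum_distrib_right[symmetric] f_def by simp
    qed
    also have "\<dots> = (\<Sum>y\<in>T'. of_real (P / Q * ?q y) * (e y i * cnj (e y j)))"
      by (rule sum.reindex_bij_betw[OF s])
    also have "\<dots> = (\<Sum>y<D ^ n. of_real (if y \<in> T' then P / Q * ?q y else 0) * (e y i * cnj (e y j)))"
      using T(2) by (intro sum.mono_neutral_cong_left) auto
    finally have typical: "(\<Sum>x\<in>T. of_real (?p x) * B x)
        = (\<Sum>y<D ^ n. of_real (if y \<in> T' then P / Q * ?q y else 0) * (e y i * cnj (e y j)))" .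
    have "protocol_output \<rho> \<sigma> n g \<psi> U $$ (i, j)
        = (\<Sum>(x, l)\<in>{..<d ^ n} \<times> {..<?B}. of_real (?p x) * G x (i * ?B + l) * cnj (G x (j * ?B + l)))"
      using outerD(2)[OF out ij] by (simp add: split_def)
    also have "\<dots> = (\<Sum>x<d ^ n. of_real (?p x) * B x)"
      unfolding B_def by (simp add: sum_distrib_left mult.assoc flip: sum.cartesian_product)
    also have "\<dots> = (\<Sum>x\<in>?R. of_real (?p x) * B x) + (\<Sum>x\<in>T. of_real (?p x) * B x)"
      using T(1) by (intro sum.subset_diff) auto
    finally have split: "protocol_output \<rho> \<sigma> n g \<psi> U $$ (i, j)
      = (\<Sum>x\<in>?R. of_real (?p x) * B x) + (\<Sum>x\<in>T. of_real (?p x) * B x)" .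
    have "\<Delta> $$ (i, j) = protocol_output \<rho> \<sigma> n g \<psi> U $$ (i, j) - copies \<sigma> n $$ (i, j)"
      using outerD(1)[OF out] outerD(1)[OF cop] ij unfolding \<Delta>_def by simp
    also have "\<dots> = (\<Sum>y<D ^ n. of_real (w y) * e y i * cnj (e y j)) + (\<Sum>x\<in>?R. of_real (?p x) * B x)"
      unfolding split typical outerD(2)[OF cop ij] w_def
      by (simp add: left_diff_distrib sum_subtractf mult.assoc)
    also have "(\<Sum>x\<in>?R. of_real (?p x) * B x) = (\<Sum>(x, l)\<in>?R \<times> {..<?B}. of_real (?p x) * G x (i * ?B + l) * cnj (G x (j * ?B + l)))"
      unfolding B_def by (simp add: sum_distrib_left mult.assoc flip: sum.cartesian_product)
    finally show "\<Delta> $$ (i, j) = (\<Sum>z\<in>{..<D ^ n} <+> ?R \<times> {..<?B}. of_real (case z of Inl x \<Rightarrow> w x | Inr (x, l) \<Rightarrow> ?p x) *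
        (case z of Inl x \<Rightarrow> e x | Inr (x, l) \<Rightarrow> \<lambda>i. G x (i * ?B + l)) i *
        cnj ((case z of Inl x \<Rightarrow> e x | Inr (x, l) \<Rightarrow> \<lambda>i. G x (i * ?B + l)) j))"
      by (simp add: sum.Plus split_def)
  qed
  from trace_norm_le[OF \<Delta>_outer]
  have "trace_norm \<Delta> \<le> (\<Sum>y<D ^ n. \<bar>w y\<bar> * norm_sq ?A (e y))
      + (\<Sum>(x, l)\<in>?R \<times> {..<?B}. \<bar>?p x\<bar> * norm_sq ?A (\<lambda>i. G x (i * ?B + l)))"
    by (simp add: sum.Plus split_def)
  also have "(\<Sum>y<D ^ n. \<bar>w y\<bar> * norm_sq ?A (e y)) = (\<Sum>y<D ^ n. \<bar>w y\<bar>)"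
    using orthonormal_norm_sq[OF oe] by simp
  also have "(\<Sum>(x, l)\<in>?R \<times> {..<?B}. \<bar>?p x\<bar> * norm_sq ?A (\<lambda>i. G x (i * ?B + l))) = (\<Sum>x\<in>?R. ?p x * norm_sq (?A * ?B) (G x))"
    unfolding norm_sq_blocks using p0 by (simp add: sum_distrib_left flip: sum.cartesian_product)
  also have "\<dots> = (\<Sum>x\<in>?R. ?p x)"
    using orthonormal_norm_sq[OF oG] by (intro sum.cong) auto
  also have "\<dots> = 1 - P"
    using sum.subset_diff[OF T(1), of ?p] sum_tensor_weight[OF \<rho>(3), of n] P(1) by simp
  also have "(\<Sum>y<D ^ n. \<bar>w y\<bar>) = (\<Sum>y\<in>{..<D ^ n} - T'. \<bar>w y\<bar>) + (\<Sum>y\<in>T'. \<bar>w y\<bar>)"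
    using T(2) by (intro sum.subset_diff) auto
  also have "(\<Sum>y\<in>{..<D ^ n} - T'. \<bar>w y\<bar>) = (\<Sum>y\<in>{..<D ^ n} - T'. ?q y)"
    using q0 unfolding w_def by (intro sum.cong) auto
  also have "\<dots> = 1 - Q"
    using sum.subset_diff[OF T(2), of ?q] sum_tensor_weight[OF \<sigma>(3), of n] Q(1) by simp
  also have "(\<Sum>y\<in>T'. \<bar>w y\<bar>) = (\<Sum>y\<in>T'. \<bar>P / Q - 1\<bar> * ?q y)"
  proof (intro sum.cong refl)
    fix y assume "y \<in> T'"
    then have "\<bar>w y\<bar> = \<bar>(P / Q - 1) * ?q y\<bar>" unfolding w_def by (simp add: left_diff_distrib)
    then show "\<bar>w y\<bar> = \<bar>P / Q - 1\<bar> * ?q y" using Tpos(2)[OF \<open>y \<in> T'\<close>] by (simp add: abs_mult)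
  qed
  also have "\<dots> = \<bar>P / Q - 1\<bar> * Q" unfolding Q(1) by (simp add: sum_distrib_left)
  also have "\<dots> = \<bar>(P / Q - 1) * Q\<bar>" using Q(2) by (simp add: abs_mult)
  also have "(P / Q - 1) * Q = P - Q" using Q(2) by (simp add: field_simps)
  finally have "trace_norm \<Delta> \<le> 1 - Q + \<bar>P - Q\<bar> + (1 - P)" by simp
  moreover have "P \<le> 1" unfolding P(1) sum_tensor_weight[OF \<rho>(3), of n, symmetric]
    using T(1) p0 by (intro sum_mono2) auto
  moreover have "Q \<le> 1" unfolding Q(1) sum_tensor_weight[OF \<sigma>(3), of n, symmetric]
    using T(2) q0 by (intro sum_mono2) auto
  \<comment> \<open>As \<open>P\<close> and \<open>Q\<close> are at most 1,
    \<open>\<bar>P - Q\<bar>\<close> is at most the larger of \<open>1 - P\<close> and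
    \<open>1 - Q\<close>.\<close>
  ultimately have "trace_norm \<Delta> \<le> 2 * ((1 - P) + (1 - Q))" by (simp add: abs_if split: if_splits)
  \<comment> \<open>The lower bound for the empty family.\<close>
  moreover have "0 \<le> trace_norm \<Delta>"
    using trace_norm_ge[OF \<Delta>_outer, of "{}"] by (simp add: orthonormal_def)
  ultimately show ?thesis using \<psi> U(1) unfolding \<Delta>_def by blast
qed

section \<open>Asymptotics\<close>

lemma copy_qubits_bounds:
  assumes "1 \<le> dim_row \<rho>"
  shows "real n * qubits \<rho> \<le> real (copy_qubits \<rho> n)" "real (copy_qubits \<rho> n) \<le> real n * qubits \<rho> + 1"
proof -
  have "0 \<le> real n * qubits \<rho>" unfolding qubits_def using assms by simp
  then show "real n * qubits \<rho> \<le> real (copy_qubits \<rho> n)" "real (copy_qubits \<rho> n) \<le> real n * qubits \<rho> + 1"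
    unfolding copy_qubits_def by linarith+
qed

lemma card_le_of_weight:
  assumes "finite T" "\<And>x. x \<in> T \<Longrightarrow> 2 powr (- a) \<le> w x" "(\<Sum>x\<in>T. w x) \<le> 1"
  shows "real (card T) \<le> 2 powr a"
proof -
  have "real (card T) * 2 powr (- a) = (\<Sum>x\<in>T. 2 powr (- a))" by simp
  also have "\<dots> \<le> (\<Sum>x\<in>T. w x)" using assms(2) by (rule sum_mono)
  also have "\<dots> \<le> 1" by (rule assms(3))
  finally have "real (card T) * 2 powr (- a) * 2 powr a \<le> 1 * 2 powr a" by (intro mult_right_mono) auto
  then show ?thesis by (simp add: mult.assoc flip: powr_add)
qed

text \<open>The allowed deviation of the log-likelihood must be \<open>o(n)\<close>, to cost no rate, but above \<open>sqrt n\<close>, for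
  Chebyshev's inequality to give a vanishing error.\<close>

definition fluct :: "nat \<Rightarrow> real" where "fluct n = real n powr (3 / 4)"

lemma fluct_pos: "0 < n \<Longrightarrow> 0 < fluct n"
  unfolding fluct_def by simp

lemma fluct_nonneg: "0 \<le> fluct n"
  unfolding fluct_def by simp

lemma fluct_sublinear: "(\<lambda>n. (2 * fluct n + c) / real n) \<longlonglongrightarrow> 0"
  unfolding fluct_def by real_asymp

lemma fluct_variance: "(\<lambda>n. real n * V / (fluct n)\<^sup>2) \<longlonglongrightarrow> 0"
proof -
  have "(\<lambda>n. V * (real n / (fluct n)\<^sup>2)) \<longlonglongrightarrow> V * 0"
    unfolding fluct_def by (intro tendsto_mult tendsto_const) real_asymp
  then show ?thesis by (simp add: mult.commute)
qed

text \<open>The typical set estimate with deviation \<open>fluct n\<close> and an error sequence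
  \<open>\<epsilon>\<close>. The case \<open>n = 0\<close> is excluded because
  \<open>fluct 0 = 0\<close>, while Chebyshev's inequality needs a positive deviation.\<close>

definition typical_bound :: "nat \<Rightarrow> (nat \<Rightarrow> real) \<Rightarrow> real \<Rightarrow> (nat \<Rightarrow> real) \<Rightarrow> bool" where
  "typical_bound d p S \<epsilon> \<longleftrightarrow> \<epsilon> \<longlonglongrightarrow> 0 \<and> (\<forall>n>0. \<exists>T\<subseteq>{..<d ^ n}.
    (\<forall>x\<in>T. 2 powr (- (real n * S) - fluct n) \<le> tensor_weight p d n x \<and>
            tensor_weight p d n x \<le> 2 powr (- (real n * S) + fluct n)) \<and>
    1 - \<epsilon> n \<le> (\<Sum>x\<in>T. tensor_weight p d n x))"

lemma typical_boundE:
  assumes "typical_bound d p S \<epsilon>" "0 < n"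
  obtains T where "T \<subseteq> {..<d ^ n}"
    "\<And>x. x \<in> T \<Longrightarrow> 2 powr (- (real n * S) - fluct n) \<le> tensor_weight p d n x"
    "\<And>x. x \<in> T \<Longrightarrow> tensor_weight p d n x \<le> 2 powr (- (real n * S) + fluct n)"
    "1 - \<epsilon> n \<le> (\<Sum>x\<in>T. tensor_weight p d n x)"
proof -
  from assms obtain T where T: "T \<subseteq> {..<d ^ n}"
    "\<forall>x\<in>T. 2 powr (- (real n * S) - fluct n) \<le> tensor_weight p d n x \<and>
            tensor_weight p d n x \<le> 2 powr (- (real n * S) + fluct n)"
    "1 - \<epsilon> n \<le> (\<Sum>x\<in>T. tensor_weight p d n x)"
    unfolding typical_bound_def by (elim conjE allE[of _ n] impE exE) simp_all
  show ?thesis by (rule that[OF T(1) _ _ T(3)]) (use T(2) in auto)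
qed

lemma density_typical:
  assumes "density_mat d \<rho>"
  shows "\<exists>u p \<epsilon>. decomp d \<rho> u p \<and> (\<forall>x<d. 0 \<le> p x) \<and> (\<Sum>x<d. p x) = 1 \<and>
    typical_bound d p (vn_entropy \<rho>) \<epsilon>"
proof -
  obtain u p where u: "decomp d \<rho> u p" "\<And>x. x < d \<Longrightarrow> 0 \<le> p x" "(\<Sum>x<d. p x) = 1"
    using density_decomp[OF assms] by blast
  obtain V where V: "\<And>n t. 0 < t \<Longrightarrow> (\<exists>T\<subseteq>{..<d ^ n}.
    (\<forall>x\<in>T. 2 powr (- (real n * vn_entropy \<rho>) - t) \<le> tensor_weight p d n x \<and>
            tensor_weight p d n x \<le> 2 powr (- (real n * vn_entropy \<rho>) + t)) \<and>
    1 - real n * V / t\<^sup>2 \<le> (\<Sum>x\<in>T. tensor_weight p d n x))"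
    using typical_set_exists[OF u(2,3) vn_entropy_decomp[OF u(1)]] by blast
  have "typical_bound d p (vn_entropy \<rho>) (\<lambda>n. real n * V / (fluct n)\<^sup>2)"
    unfolding typical_bound_def using fluct_variance[of V] V[OF fluct_pos] by blast
  then show ?thesis using u by blast
qed

section \<open>Necessity and sufficiency of the rate\<close>

lemma density_dim:
  assumes "density_mat d \<rho>"
  shows "dim_row \<rho> = d" "0 < d"
proof -
  show d: "dim_row \<rho> = d" using assms unfolding density_mat_def psd_mat_def by auto
  show "0 < d"
  proof (rule ccontr)
    assume "\<not> 0 < d"
    then have "mat_trace \<rho> = 0" unfolding mat_trace_def d by simp
    then show False using assms unfolding density_mat_def by simp
  qed
qed

text \<open>Once the error is below a constant, the dimension \<open>card T * 2 ^ g\<close> times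
  the bound on the typical weights of \<open>\<sigma>\<close> must stay above a constant; taking
  logarithms bounds \<open>g\<close>.\<close>

lemma garbage_lower_bound:
  assumes \<rho>: "density_mat d \<rho>" and \<sigma>: "density_mat D \<sigma>"
    and prot: "noiseless_protocol \<rho> \<sigma> k g \<psi> U"
  shows "eventually (\<lambda>n. real n * (vn_entropy \<sigma> - vn_entropy \<rho>) - 2 * fluct n - 1 \<le> real (g n)) sequentially"
proof -
  obtain u p \<epsilon> where u: "decomp d \<rho> u p" "\<And>x. x < d \<Longrightarrow> 0 \<le> p x" "(\<Sum>x<d. p x) = 1"
    and tp: "typical_bound d p (vn_entropy \<rho>) \<epsilon>"
    using density_typical[OF \<rho>] by blast
  obtain v q \<epsilon>' where v: "decomp D \<sigma> v q" "\<And>x. x < D \<Longrightarrow> 0 \<le> q x" "(\<Sum>x<D. q x) = 1"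
    and tq: "typical_bound D q (vn_entropy \<sigma>) \<epsilon>'"
    using density_typical[OF \<sigma>] by blast
  let ?\<tau> = "\<lambda>n. trace_norm (protocol_output \<rho> \<sigma> n (g n) (\<psi> n) (U n) - copies \<sigma> n)"
  have "?\<tau> \<longlonglongrightarrow> 0" using prot unfolding noiseless_protocol_def by blast
  then have "eventually (\<lambda>n. ?\<tau> n < 1 / 4) sequentially"
    by (rule order_tendstoD) simp
  moreover have "\<epsilon> \<longlonglongrightarrow> 0" "\<epsilon>' \<longlonglongrightarrow> 0" using tp tq unfolding typical_bound_def by auto
  then have "eventually (\<lambda>n. \<epsilon> n < 1 / 8) sequentially" "eventually (\<lambda>n. \<epsilon>' n < 1 / 8) sequentially"
    using order_tendstoD(2)[of \<epsilon> 0 sequentially "1 / 8"] order_tendstoD(2)[of \<epsilon>' 0 sequentially "1 / 8"] by simp_all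
  moreover have "eventually (\<lambda>n. n > 0) sequentially" by (rule eventually_gt_at_top)
  ultimately show ?thesis
  proof eventually_elim
    case (elim n)
    let ?p = "tensor_weight p d n" and ?q = "tensor_weight q D n"
    let ?a = "real n * vn_entropy \<rho>" and ?b = "real n * vn_entropy \<sigma>"
    obtain T where T: "T \<subseteq> {..<d ^ n}" "\<And>x. x \<in> T \<Longrightarrow> 2 powr (- ?a - fluct n) \<le> ?p x"
      "\<And>x. x \<in> T \<Longrightarrow> ?p x \<le> 2 powr (- ?a + fluct n)" "1 - \<epsilon> n \<le> (\<Sum>x\<in>T. ?p x)"
      by (rule typical_boundE[OF tp elim(4)]) (rule that, blast+)
    obtain T' where T': "T' \<subseteq> {..<D ^ n}" "\<And>y. y \<in> T' \<Longrightarrow> 2 powr (- ?b - fluct n) \<le> ?q y"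
      "\<And>y. y \<in> T' \<Longrightarrow> ?q y \<le> 2 powr (- ?b + fluct n)" "1 - \<epsilon>' n \<le> (\<Sum>y\<in>T'. ?q y)"
      by (rule typical_boundE[OF tq elim(4)]) (rule that, blast+)
    have pr: "copy_qubits \<rho> n + k n = copy_qubits \<sigma> n + g n" "\<psi> n \<in> carrier_vec (2 ^ k n)" "\<psi> n \<bullet>c \<psi> n = 1"
      "unitary_mat (2 ^ (copy_qubits \<rho> n + k n)) (U n)"
      using prot unfolding noiseless_protocol_def by blast+
    have card: "real (card T) \<le> 2 powr (real n * vn_entropy \<rho> + fluct n)"
    proof (rule card_le_of_weight)
      show "finite T" using T(1) finite_subset by auto
      show "2 powr (- (real n * vn_entropy \<rho> + fluct n)) \<le> tensor_weight p d n x" if "x \<in> T" for x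
        using T(2)[OF that] by (simp only: minus_add_distrib diff_conv_add_uminus)
      have "(\<Sum>x\<in>T. tensor_weight p d n x) \<le> (\<Sum>x<d ^ n. tensor_weight p d n x)"
        using T(1) tensor_weight_nonneg[of d p, OF u(2)] by (intro sum_mono2) auto
      then show "(\<Sum>x\<in>T. tensor_weight p d n x) \<le> 1" using sum_tensor_weight[OF u(3)] by simp
    qed
    let ?m = "2 powr (- (real n * vn_entropy \<sigma>) + fluct n)"
    have "(\<Sum>x\<in>T. tensor_weight p d n x) - (1 - (\<Sum>y\<in>T'. tensor_weight q D n y)) - ?m * (real (card T) * 2 ^ g n) \<le> ?\<tau> n"
      by (rule protocol_error_lower_bound[OF u(1,2) v density_dim(2)[OF \<rho>] density_dim(2)[OF \<sigma>] pr T(1) T'(1) _ T'(3)]) auto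
    \<comment> \<open>The thresholds were chosen for \<open>1 - 1/8 - 1/8 - 1/4 = 1/2\<close>; the
      value 1/2 costs one qubit in total.\<close>
    then have "1 / 2 \<le> ?m * (real (card T) * 2 ^ g n)"
      using T(4) T'(4) elim(1-3) by linarith
    also have "\<dots> \<le> ?m * (2 powr (real n * vn_entropy \<rho> + fluct n) * 2 ^ g n)"
      using card by (intro mult_left_mono mult_right_mono) auto
    also have "\<dots> = 2 powr (- (real n * (vn_entropy \<sigma> - vn_entropy \<rho>)) + 2 * fluct n + real (g n))"
      by (simp add: powr_realpow[symmetric] algebra_simps flip: powr_add)
    finally have "2 powr (- 1) \<le> 2 powr (- (real n * (vn_entropy \<sigma> - vn_entropy \<rho>)) + 2 * fluct n + real (g n))"
      by (simp add: powr_minus)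
    then have "- 1 \<le> - (real n * (vn_entropy \<sigma> - vn_entropy \<rho>)) + 2 * fluct n + real (g n)"
      by (subst (asm) powr_le_cancel_iff) auto
    then show ?case by linarith
  qed
qed

text \<open>Counting qubits turns the bound on \<open>g\<close> into one on \<open>k\<close>.
  Rounding the input register up to whole qubits costs one more, and all corrections vanish per copy
  by \<open>fluct_sublinear\<close>.\<close>

lemma necessary_pure_qubits:
  assumes \<rho>: "density_mat d \<rho>" and \<sigma>: "density_mat D \<sigma>"
    and prot: "noiseless_protocol \<rho> \<sigma> k g \<psi> U"
  shows "ereal (qubits \<sigma> - qubits \<rho> + (vn_entropy \<sigma> - vn_entropy \<rho>)) \<le> liminf (\<lambda>n. ereal (real (k n) / real n))"
proof -
  let ?c = "qubits \<sigma> - qubits \<rho> + (vn_entropy \<sigma> - vn_entropy \<rho>)"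
  have "eventually (\<lambda>n. ?c - (2 * fluct n + 2) / real n \<le> real (k n) / real n) sequentially"
    using garbage_lower_bound[OF assms] eventually_gt_at_top[of 0]
  proof eventually_elim
    case (elim n)
    have "copy_qubits \<rho> n + k n = copy_qubits \<sigma> n + g n" using prot unfolding noiseless_protocol_def by auto
    then have "real (k n) = real (copy_qubits \<sigma> n) + real (g n) - real (copy_qubits \<rho> n)" by linarith
    moreover have "1 \<le> dim_row \<rho>" "1 \<le> dim_row \<sigma>" using density_dim[OF \<rho>] density_dim[OF \<sigma>] by auto
    ultimately have "real n * qubits \<sigma> + real (g n) - (real n * qubits \<rho> + 1) \<le> real (k n)"
      using copy_qubits_bounds(1)[of \<sigma> n] copy_qubits_bounds(2)[of \<rho> n] by linarith
    then have "real n * ?c - (2 * fluct n + 2) \<le> real (k n)"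
      using elim(1) by (simp add: algebra_simps)
    then have "(real n * ?c - (2 * fluct n + 2)) / real n \<le> real (k n) / real n"
      by (intro divide_right_mono) auto
    then show ?case using elim(2) by (simp add: diff_divide_distrib)
  qed
  then have "liminf (\<lambda>n. ereal (?c - (2 * fluct n + 2) / real n)) \<le> liminf (\<lambda>n. ereal (real (k n) / real n))"
    by (intro Liminf_mono) simp
  moreover have "liminf (\<lambda>n. ereal (?c - (2 * fluct n + 2) / real n)) = ereal ?c"
  proof (intro lim_imp_Liminf tendsto_ereal)
    show "(\<lambda>n. ?c - (2 * fluct n + 2) / real n) \<longlonglongrightarrow> ?c"
      using tendsto_diff[OF tendsto_const[of ?c] fluct_sublinear[of 2]] by simp
  qed simp
  ultimately show ?thesis by simp
qed

text \<open>The number of garbage states has to exceed the ratios between typical weights of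
  \<open>\<rho>\<close> and \<open>\<sigma>\<close> in both directions; for
  \<open>\<Delta>S \<ge> 0\<close> about \<open>n * \<Delta>S + 2 * fluct n\<close> qubits do
  this.\<close>

lemma sufficient_pure_qubits:
  assumes \<rho>: "density_mat d \<rho>" and \<sigma>: "density_mat D \<sigma>"
    and nonneg: "0 \<le> vn_entropy \<sigma> - vn_entropy \<rho>"
  shows "\<exists>k g \<psi> U. noiseless_protocol \<rho> \<sigma> k g \<psi> U \<and>
    (\<lambda>n. real (k n) / real n) \<longlonglongrightarrow> max 0 (qubits \<sigma> - qubits \<rho> + (vn_entropy \<sigma> - vn_entropy \<rho>))"
proof -
  define \<Delta> where "\<Delta> = vn_entropy \<sigma> - vn_entropy \<rho>"
  obtain u p \<epsilon> where u: "decomp d \<rho> u p" "\<And>x. x < d \<Longrightarrow> 0 \<le> p x" "(\<Sum>x<d. p x) = 1"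
    and tp: "typical_bound d p (vn_entropy \<rho>) \<epsilon>"
    using density_typical[OF \<rho>] by blast
  obtain v q \<epsilon>' where v: "decomp D \<sigma> v q" "\<And>x. x < D \<Longrightarrow> 0 \<le> q x" "(\<Sum>x<D. q x) = 1"
    and tq: "typical_bound D q (vn_entropy \<sigma>) \<epsilon>'"
    using density_typical[OF \<sigma>] by blast
  \<comment> \<open>\<open>2 * fluct n\<close> covers the spread of the log-weights on both typical
    sets; the last 2 qubits pay for the factor 2 lost in renormalisation and for the
    \<open>+ 1\<close> in the window condition.\<close>
  define g0 where "g0 n = nat \<lceil>real n * \<Delta> + 2 * fluct n\<rceil> + 2" for n
  \<comment> \<open>Truncated subtraction: if the input register is already large enough,
    \<open>k n\<close> is 0 and \<open>g n\<close> takes the surplus, hence only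
    \<open>g0 n \<le> g n\<close>. This is the source of the maximum with 0.\<close>
  define k where "k n = copy_qubits \<sigma> n + g0 n - copy_qubits \<rho> n" for n
  define g where "g n = copy_qubits \<rho> n + k n - copy_qubits \<sigma> n" for n
  have dims: "copy_qubits \<rho> n + k n = copy_qubits \<sigma> n + g n" and g0: "g0 n \<le> g n" for n
    unfolding g_def k_def by auto
  have g0_bounds: "real n * \<Delta> + 2 * fluct n + 2 \<le> real (g0 n)" "real (g0 n) \<le> real n * \<Delta> + 2 * fluct n + 3" for n
  proof -
    have "0 \<le> real n * \<Delta> + 2 * fluct n" using nonneg fluct_nonneg[of n] unfolding \<Delta>_def by simp
    then show "real n * \<Delta> + 2 * fluct n + 2 \<le> real (g0 n)" "real (g0 n) \<le> real n * \<Delta> + 2 * fluct n + 3"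
      unfolding g0_def by linarith+
  qed
  let ?\<tau> = "\<lambda>n \<psi> U. trace_norm (protocol_output \<rho> \<sigma> n (g n) \<psi> U - copies \<sigma> n)"
  \<comment> \<open>An admissible protocol is required for every \<open>n\<close>, the error bound
    only for large \<open>n\<close>; hence the implication inside the existential.\<close>
  have "\<exists>\<psi> U. \<psi> \<in> carrier_vec (2 ^ k n) \<and> \<psi> \<bullet>c \<psi> = 1 \<and> unitary_mat (2 ^ (copy_qubits \<rho> n + k n)) U \<and>
    (0 < n \<and> \<epsilon> n < 1 / 2 \<and> \<epsilon>' n < 1 / 2 \<longrightarrow> 0 \<le> ?\<tau> n \<psi> U \<and> ?\<tau> n \<psi> U \<le> 2 * (\<epsilon> n + \<epsilon>' n))" for n
  proof (cases "0 < n \<and> \<epsilon> n < 1 / 2 \<and> \<epsilon>' n < 1 / 2")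
    case False \<comment> \<open>the typical sets may be empty, and any admissible protocol will do\<close>
    obtain U where U: "unitary_mat (2 ^ (copy_qubits \<rho> n + k n)) U"
      using exists_unitary_mapping[of _ "{}"] by (auto simp: orthonormal_def)
    have "conjugate (unit_vec (2 ^ k n) 0) = (unit_vec (2 ^ k n) 0 :: complex vec)"
      by (intro eq_vecI) (auto simp: unit_vec_def)
    then have "unit_vec (2 ^ k n) 0 \<bullet>c unit_vec (2 ^ k n) 0 = (1 :: complex)" by simp
    then show ?thesis using U False by (intro exI[of _ "unit_vec (2 ^ k n) 0"] exI[of _ U]) auto
  next
    case True
    let ?p = "tensor_weight p d n" and ?q = "tensor_weight q D n"
    let ?a = "real n * vn_entropy \<rho>" and ?b = "real n * vn_entropy \<sigma>"
    obtain T where T: "T \<subseteq> {..<d ^ n}" "\<And>x. x \<in> T \<Longrightarrow> 2 powr (- ?a - fluct n) \<le> ?p x"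
      "\<And>x. x \<in> T \<Longrightarrow> ?p x \<le> 2 powr (- ?a + fluct n)" "1 - \<epsilon> n \<le> (\<Sum>x\<in>T. ?p x)"
      by (rule typical_boundE[OF tp conjunct1[OF True]]) (rule that, blast+)
    obtain T' where T': "T' \<subseteq> {..<D ^ n}" "\<And>y. y \<in> T' \<Longrightarrow> 2 powr (- ?b - fluct n) \<le> ?q y"
      "\<And>y. y \<in> T' \<Longrightarrow> ?q y \<le> 2 powr (- ?b + fluct n)" "1 - \<epsilon>' n \<le> (\<Sum>y\<in>T'. ?q y)"
      by (rule typical_boundE[OF tq conjunct1[OF True]]) (rule that, blast+)
    define P Q where "P = (\<Sum>x\<in>T. ?p x)" and "Q = (\<Sum>y\<in>T'. ?q y)"
    have P: "1 / 2 < P" "P \<le> 1"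
    proof -
      show "1 / 2 < P" using T(4) True unfolding P_def by linarith
      show "P \<le> 1" unfolding P_def sum_tensor_weight[OF u(3), of n, symmetric]
        using T(1) tensor_weight_nonneg[of d p, OF u(2)] by (intro sum_mono2) auto
    qed
    have Q: "1 / 2 < Q" "Q \<le> 1"
    proof -
      show "1 / 2 < Q" using T'(4) True unfolding Q_def by linarith
      show "Q \<le> 1" unfolding Q_def sum_tensor_weight[OF v(3), of n, symmetric]
        using T'(1) tensor_weight_nonneg[of D q, OF v(2)] by (intro sum_mono2) auto
    qed
    \<comment> \<open>Division by a number between 1/2 and 1 at most doubles an upper bound and
      preserves lower bounds.\<close>
    have normalise: "x / R \<le> 2 * y" "z \<le> x \<Longrightarrow> z \<le> x / R"
      if "0 \<le> x" "x \<le> y" "1 / 2 < R" "R \<le> 1" for x y z R :: real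
    proof -
      have "x \<le> 2 * R * y" using that mult_right_mono[of 1 "2 * R" y] by simp
      then show "x / R \<le> 2 * y" using that by (simp add: field_simps)
      show "z \<le> x / R" if "z \<le> x"
      proof -
        have "x * R \<le> x" using \<open>0 \<le> x\<close> \<open>R \<le> 1\<close> by (rule mult_left_le[rotated])
        then show ?thesis using that \<open>1 / 2 < R\<close> by (simp add: le_divide_eq order_trans[OF mult_right_mono])
      qed
    qed
    have pp: "0 < ?p x" if "x \<in> T" for x using T(2)[OF that] by (rule less_le_trans[rotated]) simp
    have qp: "0 < ?q y" if "y \<in> T'" for y using T'(2)[OF that] by (rule less_le_trans[rotated]) simp
    define z where "z = real n * \<Delta> + 2 * fluct n"
    have z: "0 \<le> z" using nonneg fluct_nonneg[of n] unfolding z_def \<Delta>_def by simp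
    have "\<exists>\<psi> U. \<psi> \<in> carrier_vec (2 ^ k n) \<and> \<psi> \<bullet>c \<psi> = 1 \<and> unitary_mat (2 ^ (copy_qubits \<rho> n + k n)) U \<and>
      0 \<le> ?\<tau> n \<psi> U \<and> ?\<tau> n \<psi> U \<le> 2 * ((1 - P) + (1 - Q))"
    proof (rule protocol_exists[OF u v density_dim(2)[OF \<rho>] density_dim(2)[OF \<sigma>] dims T(1) T'(1) pp qp P_def _ Q_def,
          where L = "2 * 2 powr z"])
      show "0 < P" "0 < Q" using P Q by auto
      show "0 < 2 * 2 powr z" by simp
      show "?p x / P \<le> 2 * 2 powr z * (?q y / Q)" if "x \<in> T" "y \<in> T'" for x y
      proof -
        have "?p x / P \<le> 2 * 2 powr (- ?a + fluct n)"
          using normalise(1)[OF _ T(3)[OF that(1)] P] pp[OF that(1)] by simp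
        \<comment> \<open>\<open>z\<close> is chosen to balance these exponents exactly.\<close>
        also have "2 powr (- ?a + fluct n) = 2 powr z * 2 powr (- ?b - fluct n)"
          unfolding z_def \<Delta>_def by (simp add: algebra_simps flip: powr_add)
        also have "2 powr (- ?b - fluct n) \<le> ?q y / Q"
          using normalise(2)[OF _ order.refl Q T'(2)[OF that(2)]] qp[OF that(2)] by simp
        finally show ?thesis by (simp add: mult.assoc)
      qed
      show "?q y / Q \<le> 2 * 2 powr z * (?p x / P)" if "x \<in> T" "y \<in> T'" for x y
      proof -
        have "?q y / Q \<le> 2 * 2 powr (- ?b + fluct n)"
          using normalise(1)[OF _ T'(3)[OF that(2)] Q] qp[OF that(2)] by simp
        \<comment> \<open>In this direction the exponents leave a surplus of
          \<open>2 * (?b - ?a)\<close>, which is where \<open>\<Delta>S \<ge> 0\<close> is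
          used.\<close>
        also have "2 powr (- ?b + fluct n) \<le> 2 powr z * 2 powr (- ?a - fluct n)"
        proof -
          have "?a \<le> ?b" using nonneg by (intro mult_left_mono) auto
          then show ?thesis unfolding z_def \<Delta>_def powr_add[symmetric] by (simp add: algebra_simps)
        qed
        also have "2 powr (- ?a - fluct n) \<le> ?p x / P"
          using normalise(2)[OF _ order.refl P T(2)[OF that(1)]] pp[OF that(1)] by simp
        finally show ?thesis by (simp add: mult.assoc)
      qed
      have "z + 2 \<le> real (g n)" using g0_bounds(1)[of n] g0[of n] unfolding z_def by linarith
      then have "2 powr (z + 2) \<le> 2 powr real (g n)" by simp
      also have "\<dots> = 2 ^ g n" by (simp add: powr_realpow)
      also have "2 powr (z + 2) = 4 * 2 powr z" by (simp add: powr_add)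
      finally have "4 * 2 powr z \<le> 2 ^ g n" .
      moreover have "1 \<le> 2 powr z" using z by (simp add: ge_one_powr_ge_zero)
      ultimately show "2 * 2 powr z + 1 \<le> 2 ^ g n" by linarith
    qed
    then obtain \<psi> U where "\<psi> \<in> carrier_vec (2 ^ k n)" "\<psi> \<bullet>c \<psi> = 1" "unitary_mat (2 ^ (copy_qubits \<rho> n + k n)) U"
      "0 \<le> ?\<tau> n \<psi> U" "?\<tau> n \<psi> U \<le> 2 * ((1 - P) + (1 - Q))" by blast
    moreover have "2 * ((1 - P) + (1 - Q)) \<le> 2 * (\<epsilon> n + \<epsilon>' n)"
    proof -
      have "1 - \<epsilon> n \<le> P" "1 - \<epsilon>' n \<le> Q" unfolding P_def Q_def by (fact T(4) T'(4))+
      then show ?thesis by argo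
    qed
    ultimately have "\<psi> \<in> carrier_vec (2 ^ k n) \<and> \<psi> \<bullet>c \<psi> = 1 \<and> unitary_mat (2 ^ (copy_qubits \<rho> n + k n)) U \<and>
      0 \<le> ?\<tau> n \<psi> U \<and> ?\<tau> n \<psi> U \<le> 2 * (\<epsilon> n + \<epsilon>' n)" by (meson order_trans)
    then show ?thesis by blast
  qed
  then obtain \<psi> U where prot: "\<And>n. \<psi> n \<in> carrier_vec (2 ^ k n)" "\<And>n. \<psi> n \<bullet>c \<psi> n = 1"
    "\<And>n. unitary_mat (2 ^ (copy_qubits \<rho> n + k n)) (U n)"
    and \<tau>: "\<And>n. 0 < n \<Longrightarrow> \<epsilon> n < 1 / 2 \<Longrightarrow> \<epsilon>' n < 1 / 2 \<Longrightarrow> 0 \<le> ?\<tau> n (\<psi> n) (U n) \<and> ?\<tau> n (\<psi> n) (U n) \<le> 2 * (\<epsilon> n + \<epsilon>' n)"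
    by metis
  have \<epsilon>: "\<epsilon> \<longlonglongrightarrow> 0" "\<epsilon>' \<longlonglongrightarrow> 0" using tp tq unfolding typical_bound_def by auto
  have ev: "eventually (\<lambda>n. 0 \<le> ?\<tau> n (\<psi> n) (U n) \<and> ?\<tau> n (\<psi> n) (U n) \<le> 2 * (\<epsilon> n + \<epsilon>' n)) sequentially"
    using order_tendstoD(2)[OF \<epsilon>(1), of "1 / 2", simplified] order_tendstoD(2)[OF \<epsilon>(2), of "1 / 2", simplified]
      eventually_gt_at_top[of "0 :: nat"]
  proof eventually_elim
    case (elim n)
    show ?case by (rule \<tau>) (use elim in auto)
  qed
  have "(\<lambda>n. 2 * (\<epsilon> n + \<epsilon>' n)) \<longlonglongrightarrow> 0"
    using tendsto_mult[OF tendsto_const[of 2] tendsto_add[OF \<epsilon>]] by simp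
  then have "(\<lambda>n. ?\<tau> n (\<psi> n) (U n)) \<longlonglongrightarrow> 0"
    using tendsto_sandwich[OF eventually_mono[OF ev conjunct1] eventually_mono[OF ev conjunct2] tendsto_const] by simp
  then have "noiseless_protocol \<rho> \<sigma> k g \<psi> U"
    unfolding noiseless_protocol_def using prot dims by blast
  moreover have "(\<lambda>n. real (k n) / real n) \<longlonglongrightarrow> max 0 (qubits \<sigma> - qubits \<rho> + \<Delta>)"
  proof -
    let ?c = "qubits \<sigma> - qubits \<rho> + \<Delta>"
    let ?a = "\<lambda>n. (real (copy_qubits \<sigma> n) + real (g0 n) - real (copy_qubits \<rho> n)) / real n"
    have dim: "1 \<le> dim_row \<rho>" "1 \<le> dim_row \<sigma>" using density_dim[OF \<rho>] density_dim[OF \<sigma>] by auto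
    \<comment> \<open>Each register is off by at most one qubit, and \<open>g0 n\<close> by at most
      \<open>2 * fluct n + 3\<close>.\<close>
    have bnd: "norm (?a n - ?c) \<le> (2 * fluct n + 5) / real n" if "0 < n" for n
    proof -
      have "\<bar>real (copy_qubits \<sigma> n) + real (g0 n) - real (copy_qubits \<rho> n) - real n * ?c\<bar> \<le> 2 * fluct n + 5"
        using copy_qubits_bounds[OF dim(1), of n] copy_qubits_bounds[OF dim(2), of n] g0_bounds[of n] fluct_nonneg[of n]
        by (simp add: algebra_simps)
      then have "\<bar>(real (copy_qubits \<sigma> n) + real (g0 n) - real (copy_qubits \<rho> n) - real n * ?c) / real n\<bar> \<le> (2 * fluct n + 5) / real n"
        unfolding abs_divide by (simp add: divide_right_mono)
      then show ?thesis using that by (simp add: diff_divide_distrib)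
    qed
    have "(\<lambda>n. ?a n - ?c) \<longlonglongrightarrow> 0"
    proof (rule tendsto_0_le[OF fluct_sublinear[of 5]])
      show "eventually (\<lambda>n. norm (?a n - ?c) \<le> norm ((2 * fluct n + 5) / real n) * 1) sequentially"
        using eventually_gt_at_top[of "0 :: nat"]
      proof eventually_elim
        case (elim n)
        show ?case unfolding mult_1_right real_norm_def
          by (rule order_trans[OF bnd[OF elim, unfolded real_norm_def] abs_ge_self])
      qed
    qed
    then have "?a \<longlonglongrightarrow> ?c" by (simp add: LIM_zero_iff)
    then have "(\<lambda>n. max 0 (?a n)) \<longlonglongrightarrow> max 0 ?c" by (intro tendsto_max tendsto_const)
    moreover have "max 0 (?a n) = real (k n) / real n" for n
    proof (cases "copy_qubits \<rho> n \<le> copy_qubits \<sigma> n + g0 n")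
      case True
      then have "real (k n) = real (copy_qubits \<sigma> n) + real (g0 n) - real (copy_qubits \<rho> n)"
        unfolding k_def by (simp add: of_nat_diff)
      then have "?a n = real (k n) / real n" by (simp only:)
      then show ?thesis
        by (simp only: max.absorb2[OF divide_nonneg_nonneg[OF of_nat_0_le_iff of_nat_0_le_iff]])
    next
      case False
      then have "real (copy_qubits \<sigma> n) + real (g0 n) - real (copy_qubits \<rho> n) \<le> 0" by linarith
      then have "?a n \<le> 0" by (simp add: divide_nonpos_nonneg)
      then show ?thesis using False unfolding k_def by simp
    qed
    ultimately show ?thesis by simp
  qed
  ultimately show ?thesis unfolding \<Delta>_def by blast
qed

text \<open>The maximum with 0 is there because \<open>k n\<close> is a natural number. For
  \<open>\<Delta>S < 0\<close> the count of qubits alone, with \<open>g n \<ge> 0\<close>, keeps the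
  rate from falling below \<open>\<Delta>N\<close>, so \<open>\<Delta>N + \<Delta>S\<close> is
  attained as a rate only under a sign condition such as \<open>0 \<le> \<Delta>S\<close> when
  \<open>\<Delta>N > 0\<close>.\<close>

theorem proposition3:
  fixes \<rho> \<sigma> :: "complex mat" and d D :: nat and \<Delta>N \<Delta>S :: real
  assumes "density_mat d \<rho>" and "density_mat D \<sigma>"
    and "\<Delta>N = qubits \<sigma> - qubits \<rho>"
    and "\<Delta>S = vn_entropy \<sigma> - vn_entropy \<rho>"
  shows "(\<forall>k g \<psi> U. noiseless_protocol \<rho> \<sigma> k g \<psi> U \<longrightarrow>
            ereal (\<Delta>N + \<Delta>S) \<le> liminf (\<lambda>n. ereal (real (k n) / real n))) \<and>
         (0 \<le> \<Delta>S \<longrightarrow>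
            (\<exists>k g \<psi> U. noiseless_protocol \<rho> \<sigma> k g \<psi> U \<and>
               (\<lambda>n. real (k n) / real n) \<longlonglongrightarrow> max 0 (\<Delta>N + \<Delta>S)))"
  using necessary_pure_qubits[OF assms(1,2)] sufficient_pure_qubits[OF assms(1,2)]
  unfolding assms(3,4) by blast

end
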